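(* Let $m=n=4$, let $a>b>0$ be real numbers, and consider the matrices $$U(a,b)=\begin{pmatrix}a&b&b&b\\ b&a&b&b\\ b&b&a&b\\ b&b&b&a\end{pmatrix},\qquad P(a,b)=\frac{1}{8(a+3b)}\begin{pmatrix}a+b&a+b&2b&2b\\ a+b&a+b&2b&2b\\ 2b&2b&a+b&a+b\\ 2b&2b&a+b&a+b\end{pmatrix}.$$ Then the distribution $P(a,b)$ maximizes the likelihood function for the data matrix $U(a,b)$ on $\mathcal{M}_2$.
   Context: $\mathcal{M}_2$ is the set of all real $4\times4$ matrices $P=(p_{ij})$ with non-negative entries summing to $1$ and with $\operatorname{rank}(P)\le 2$. The likelihood function for a data matrix $U=(u_{ij})$ is $\ell_U(P)=\prod_{i,j}p_{ij}^{u_{ij}}\big/\bigl(\sum_{i,j}p_{ij}\bigr)^{u_{++}}$, where $u_{++}=\sum_{i,j}u_{ij}$; on $\mathcal{M}_2$ it equals $\prod_{i,j}p_{ij}^{u_{ij}}$. "Maximizes" means that $P(a,b)$ attains the global maximum. *)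

theory Defs
  imports "HOL-Analysis.Analysis"
begin

text \<open>
  Non-negative base, real exponent, with the convention that every base to the power 0 is 1,
  so that zero counts contribute a factor 1 to the likelihood; HOL's \<open>0 powr 0\<close> is 0.
\<close>

definition rpow :: "real \<Rightarrow> real \<Rightarrow> real" where
  "rpow x u = (if u = 0 then 1 else x powr u)"

definition entry_sum :: "real ^ 'n ^ 'm \<Rightarrow> real" where
  "entry_sum A = (\<Sum>i\<in>UNIV. \<Sum>j\<in>UNIV. A $ i $ j)"

definition likelihood :: "real ^ 'n ^ 'm \<Rightarrow> real ^ 'n ^ 'm \<Rightarrow> real" where
  "likelihood U P =
     (\<Prod>i\<in>UNIV. \<Prod>j\<in>UNIV. rpow (P $ i $ j) (U $ i $ j)) / rpow (entry_sum P) (entry_sum U)"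

definition M2 :: "(real ^ 4 ^ 4) set" where
  "M2 = {P. (\<forall>i j. 0 \<le> P $ i $ j) \<and> entry_sum P = 1 \<and> rank P \<le> 2}"

definition U_mat :: "real \<Rightarrow> real \<Rightarrow> real ^ 4 ^ 4" where
  "U_mat a b = vector
     [vector [a, b, b, b],
      vector [b, a, b, b],
      vector [b, b, a, b],
      vector [b, b, b, a]]"

definition P_mat :: "real \<Rightarrow> real \<Rightarrow> real ^ 4 ^ 4" where
  "P_mat a b = (1 / (8 * (a + 3 * b))) *\<^sub>R vector
     [vector [a + b, a + b, 2 * b, 2 * b],
      vector [a + b, a + b, 2 * b, 2 * b],
      vector [2 * b, 2 * b, a + b, a + b],
      vector [2 * b, 2 * b, a + b, a + b]]"

end

theory Submission
  imports Defs
begin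

text \<open>
  Why the theorem holds.  The likelihood is continuous on the compact set of admissible matrices, so
  it has a maximizer \<open>P\<close>, and all entries of \<open>P\<close> are positive.  Comparing \<open>P\<close> with the matrices obtained
  by rescaling one row or one column shows that all margins of \<open>P\<close> equal \<open>1/4\<close>.  A matrix of rank at
  most two with these margins differs from the uniform matrix by a matrix of rank at most one, so
  \<open>P\<^sub>i\<^sub>j = (1 + x\<^sub>i y\<^sub>j) / 16\<close> with \<open>\<Sum> x\<^sub>i = \<Sum> y\<^sub>j = 0\<close>.  Comparing \<open>P\<close> with the matrices obtained by
  exchanging two columns shows that \<open>x\<close> and \<open>y\<close> are similarly ordered (here \<open>a > b\<close> is used).

  It remains to bound \<open>D\<^sup>a F\<^sup>b\<close>, where \<open>D\<close> is the product of the four numbers \<open>1 + x\<^sub>i y\<^sub>i\<close> and \<open>F\<close> the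
  product of the twelve numbers \<open>1 + x\<^sub>i y\<^sub>j\<close> with \<open>i \<noteq> j\<close>.  The heart of the proof is the lemma
  \<open>similarly_ordered_bound\<close>, which does not mention \<open>a\<close> and \<open>b\<close>: there is a \<open>\<delta>\<close> between \<open>0\<close> and \<open>2\<close> with
  \<open>D \<le> \<delta>\<^sup>4\<close> and \<open>F \<le> (\<delta> (2 - \<delta>)\<^sup>2)\<^sup>4\<close>.  Equality holds for \<open>x = y = (s, s, -s, -s)\<close> with
  \<open>\<delta> = 1 + s\<^sup>2\<close>, which is the shape of \<open>P(a, b)\<close>.  Hence \<open>D\<^sup>a F\<^sup>b\<close> is at most the fourth power of
  \<open>\<delta>\<^bsup>a+b\<^esup> (2 - \<delta>)\<^bsup>2b\<^esup>\<close>, a function of one variable whose maximum, at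
  \<open>\<delta> = 2 (a + b) / (a + 3 b)\<close>, is the value that belongs to \<open>P(a, b)\<close>.

  For the key lemma write \<open>x\<close> in the coordinates \<open>u\<^sub>1, u\<^sub>2, u\<^sub>3\<close> with
  \<open>x = (u\<^sub>1 + u\<^sub>2 + u\<^sub>3, u\<^sub>1 - u\<^sub>2 - u\<^sub>3, - u\<^sub>1 + u\<^sub>2 - u\<^sub>3, - u\<^sub>1 - u\<^sub>2 + u\<^sub>3)\<close>, which exist because the entries of \<open>x\<close> sum
  to zero, and \<open>y\<close> likewise with \<open>v\<^sub>1, v\<^sub>2, v\<^sub>3\<close>.  For decreasing \<open>x\<close> and \<open>y\<close> this gives
  \<open>u\<^sub>1 \<ge> u\<^sub>2 \<ge> \<bar>u\<^sub>3\<bar>\<close> and \<open>v\<^sub>1 \<ge> v\<^sub>2 \<ge> \<bar>v\<^sub>3\<bar>\<close>.  Put \<open>k\<^sub>i = u\<^sub>i v\<^sub>i\<close>.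

  If \<open>k\<^sub>3 \<le> 0\<close>, bound the product of the factors at \<open>(i, j)\<close> and \<open>(5 - i, 5 - j)\<close> by the square of their
  mean.  What is left is an inequality between the means, proved in \<open>offdiagonal_bound_nonpos\<close>.

  If \<open>k\<^sub>3 > 0\<close>, bound the product of the factors at \<open>(i, j)\<close> and \<open>(j, i)\<close> by the square of their mean.
  This bounds \<open>F\<close> by an expression in \<open>k\<^sub>1, k\<^sub>2, k\<^sub>3\<close> alone.  These numbers also bound \<open>D\<close>: the mean of the
  diagonal factors is \<open>1 + k\<^sub>1 + k\<^sub>2 + k\<^sub>3\<close>, for given \<open>k\<^sub>i\<close> their spread is least when \<open>u\<close> and \<open>v\<close> are
  proportional, and \<open>prod_hadamard_le\<close> turns a lower bound for the spread into an upper bound for the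
  product.  The resulting polynomial
  inequality in \<open>k\<^sub>1 \<ge> k\<^sub>2 \<ge> k\<^sub>3\<close> is \<open>offdiagonal_bound_pos\<close>.
\<close>

section \<open>Inequalities between means\<close>

lemma mult_le_mean_square:
  fixes s t :: real
  shows "s * t \<le> ((s + t) / 2)\<^sup>2"
proof -
  have "((s + t) / 2)\<^sup>2 - s * t = ((s - t) / 2)\<^sup>2"
    by (simp add: power2_eq_square field_simps)
  then show ?thesis by (smt (verit) zero_le_power2)
qed

lemma prod4_le_mean_power4:
  fixes s1 s2 s3 s4 :: real
  assumes "0 \<le> s1" "0 \<le> s2" "0 \<le> s3" "0 \<le> s4"
  shows "s1 * s2 * s3 * s4 \<le> ((s1 + s2 + s3 + s4) / 4)^4"
proof -
  have "(s1 * s2) * (s3 * s4) \<le> ((s1 + s2) / 2)\<^sup>2 * ((s3 + s4) / 2)\<^sup>2"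
    using assms by (intro mult_mono mult_le_mean_square) auto
  also have "\<dots> = (((s1 + s2) / 2) * ((s3 + s4) / 2))\<^sup>2"
    by (simp only: power_mult_distrib)
  also have "\<dots> \<le> ((((s1 + s2) / 2 + (s3 + s4) / 2) / 2)\<^sup>2)\<^sup>2"
    using assms by (intro power_mono mult_le_mean_square) auto
  also have "\<dots> = ((s1 + s2 + s3 + s4) / 4)^4"
    by (simp add: add_divide_distrib add.assoc)
  finally show ?thesis by (simp add: mult.assoc)
qed

lemma two_pairs_bound:
  fixes s t s' t' m m' :: real
  assumes "0 < s" "0 < t" "0 < s'" "0 < t'" "s + t = 2 * m" "s' + t' = 2 * m'"
  shows "0 \<le> s * t * (s' * t')" "s * t * (s' * t') \<le> (m * m')\<^sup>2" "0 < m" "0 < m'"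
proof -
  have "s * t * (s' * t') \<le> m\<^sup>2 * m'\<^sup>2"
    using assms mult_le_mean_square[of s t] mult_le_mean_square[of s' t'] by (intro mult_mono) auto
  then show "s * t * (s' * t') \<le> (m * m')\<^sup>2" by (simp only: power_mult_distrib)
qed (use assms in simp_all)

lemma mult3_mono:
  fixes a1 a2 a3 b1 b2 b3 :: real
  assumes "0 \<le> a1" "0 \<le> a2" "0 \<le> a3" "a1 \<le> b1" "a2 \<le> b2" "a3 \<le> b3"
  shows "a1 * a2 * a3 \<le> b1 * b2 * b3"
  using assms by (intro mult_mono) auto

lemma bernoulli_power4:
  fixes y :: real
  shows "1 - 4 * y \<le> (1 - y) ^ 4"
proof -
  have "(1 - y) ^ 4 - (1 - 4 * y) = y\<^sup>2 * ((y - 2)\<^sup>2 + 2)" by algebra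
  then show ?thesis by (smt (verit) mult_nonneg_nonneg zero_le_power2)
qed

text \<open>
  The tangent bound \<open>sqrt (M\<^sup>2 - 4 c) \<le> M - 2 c / M\<close>, squared so that it also makes sense when the
  left-hand side is negative.
\<close>

lemma diff_le_square_tangent:
  fixes M c :: real
  assumes "0 < M"
  shows "M\<^sup>2 - 4 * c \<le> (M - 2 * c / M)\<^sup>2"
proof -
  have "(M - 2 * c / M)\<^sup>2 = M\<^sup>2 - 4 * c + (2 * c / M)\<^sup>2"
    using assms by (simp add: power2_eq_square field_simps)
  then show ?thesis by simp
qed

section \<open>The diagonal factors\<close>

lemma prod_hadamard_expand:
  fixes w A B C :: real
  shows "(w + A + B + C) * (w - A - B + C) * (w - A + B - C) * (w + A - B - C)
    = (w\<^sup>2 - (A\<^sup>2 + B\<^sup>2 + C\<^sup>2))\<^sup>2 + 8 * (w * (A * B * C)) - 4 * ((A * B)\<^sup>2 + (A * C)\<^sup>2 + (B * C)\<^sup>2)"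
  by algebra

text \<open>
  Of four numbers with mean \<open>w\<close> and given variance, the product is largest for
  \<open>(w + 3 g, w - g, w - g, w - g)\<close>; a larger variance makes this value smaller.  The deviations are written in
  coordinates \<open>A, B, C\<close> because they are known only through lower bounds \<open>A\<^sub>0, B\<^sub>0, C\<^sub>0\<close>.  The proof applies
  the inequality of arithmetic and geometric means to the four numbers after multiplying them by
  weights of the form \<open>W - h\<close>, where \<open>h\<close> runs through the deviations with coordinates \<open>A\<^sub>0, B\<^sub>0, C\<^sub>0\<close>:
  the weighted sum is then decreasing in \<open>A, B, C\<close>, so these may be replaced by their lower bounds.
\<close>

lemma prod_hadamard_le:
  fixes w g A B C A0 B0 C0 :: real
  assumes g: "3 * g\<^sup>2 = A0\<^sup>2 + B0\<^sup>2 + C0\<^sup>2" "0 \<le> g" "g < w"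
    and le: "0 \<le> A0" "A0 \<le> A" "0 \<le> B0" "B0 \<le> B" "0 \<le> C0" "C0 \<le> C"
    and nonneg: "0 \<le> w + A + B + C" "0 \<le> w - A - B + C" "0 \<le> w - A + B - C" "0 \<le> w + A - B - C"
  shows "(w + A + B + C) * (w - A - B + C) * (w - A + B - C) * (w + A - B - C)
    \<le> (w + 3 * g) * (w - g) ^ 3"
proof -
  \<comment> \<open>This choice makes the weighted numbers equal in the extreme case where
    all coordinates equal \<open>g\<close>: the weights are then \<open>w - g\<close> once and \<open>w + 3 g\<close> three times.\<close>
  define W where "W = w + 2 * g"
  have Wpos: "W > 0" using g by (simp add: W_def)
  have "(A0 + B0 + C0)\<^sup>2 + (A0 - B0)\<^sup>2 + (A0 - C0)\<^sup>2 + (B0 - C0)\<^sup>2 = (3 * g)\<^sup>2"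
    using g(1) by algebra
  then have "(A0 + B0 + C0)\<^sup>2 \<le> (3 * g)\<^sup>2"
    by (smt (verit) zero_le_power2)
  then have sum0: "A0 + B0 + C0 \<le> 3 * g"
    using g(2) by (intro power2_le_imp_le[of "A0 + B0 + C0" "3 * g"]) auto
  let ?s1 = "W - A0 - B0 - C0" and ?s2 = "W + A0 + B0 - C0"
    and ?s3 = "W + A0 - B0 + C0" and ?s4 = "W - A0 + B0 + C0"
  have s: "0 \<le> ?s1" "0 \<le> ?s2" "0 \<le> ?s3" "0 \<le> ?s4"
    using sum0 g le by (simp_all add: W_def)
  have lin: "A0 * A + B0 * B + C0 * C \<ge> 3 * g\<^sup>2"
  proof -
    have "A0 * A0 \<le> A0 * A" "B0 * B0 \<le> B0 * B" "C0 * C0 \<le> C0 * C"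
      using le by (auto intro: mult_left_mono)
    then show ?thesis using g(1) by (simp add: power2_eq_square)
  qed
  let ?D = "(w + A + B + C) * (w - A - B + C) * (w - A + B - C) * (w + A - B - C)"
  let ?E = "?s1 * ?s2 * ?s3 * ?s4"
  note scaled = mult_nonneg_nonneg[OF s(1) nonneg(1)] mult_nonneg_nonneg[OF s(2) nonneg(2)]
    mult_nonneg_nonneg[OF s(3) nonneg(3)] mult_nonneg_nonneg[OF s(4) nonneg(4)]
  have mean_nonneg: "0 \<le> (?s1 * (w + A + B + C) + ?s2 * (w - A - B + C) + ?s3 * (w - A + B - C) + ?s4 * (w + A - B - C)) / 4"
    using scaled by simp
  have mean: "(?s1 * (w + A + B + C) + ?s2 * (w - A - B + C) + ?s3 * (w - A + B - C) + ?s4 * (w + A - B - C)) / 4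
      = w * W - (A0 * A + B0 * B + C0 * C)"
    by (simp add: field_simps)
  have "?E * ?D = (?s1 * (w + A + B + C)) * (?s2 * (w - A - B + C)) * (?s3 * (w - A + B - C)) * (?s4 * (w + A - B - C))"
    by (simp only: mult_ac)
  also have "\<dots> \<le> (w * W - (A0 * A + B0 * B + C0 * C)) ^ 4"
    unfolding mean[symmetric]
    using scaled by (rule prod4_le_mean_power4)
  also have "\<dots> \<le> (w * W - 3 * g\<^sup>2) ^ 4"
    using lin mean_nonneg unfolding mean by (intro power_mono) auto
  also have "w * W - 3 * g\<^sup>2 = (w + 3 * g) * (w - g)"
    by (simp add: W_def power2_eq_square algebra_simps)
  finally have upper: "?E * ?D \<le> ((w + 3 * g) * (w - g)) ^ 4" .

  have prod3: "A0 * B0 * C0 \<le> g ^ 3"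
  proof -
    \<comment> \<open>Taking \<open>g\<^sup>2\<close> as fourth factor leaves the mean \<open>g\<^sup>2\<close> of the other three unchanged.\<close>
    have "A0\<^sup>2 * B0\<^sup>2 * C0\<^sup>2 * g\<^sup>2 \<le> ((A0\<^sup>2 + B0\<^sup>2 + C0\<^sup>2 + g\<^sup>2) / 4) ^ 4"
      by (intro prod4_le_mean_power4) auto
    also have "(A0\<^sup>2 + B0\<^sup>2 + C0\<^sup>2 + g\<^sup>2) / 4 = g\<^sup>2" using g(1) by simp
    finally have *: "(A0 * B0 * C0)\<^sup>2 * g\<^sup>2 \<le> (g ^ 3)\<^sup>2 * g\<^sup>2"
      by (simp add: power_mult_distrib power2_eq_square eval_nat_numeral mult_ac)
    show ?thesis
    proof (cases "g = 0")
      case True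
      then have "A0\<^sup>2 = 0" using g(1) by (smt (verit) zero_le_power2 zero_power2)
      then show ?thesis using True by simp
    next
      case False
      then have "(A0 * B0 * C0)\<^sup>2 \<le> (g ^ 3)\<^sup>2"
        by (intro mult_right_le_imp_le[OF *]) simp
      then show ?thesis using g(2) by (intro power2_le_imp_le[of "A0 * B0 * C0" "g ^ 3"]) auto
    qed
  qed
  have prod2: "(A0 * B0)\<^sup>2 + (A0 * C0)\<^sup>2 + (B0 * C0)\<^sup>2 \<le> 3 * g ^ 4"
  proof -
    have "2 * (9 * g ^ 4 - 3 * ((A0 * B0)\<^sup>2 + (A0 * C0)\<^sup>2 + (B0 * C0)\<^sup>2))
      = (A0\<^sup>2 - B0\<^sup>2)\<^sup>2 + (A0\<^sup>2 - C0\<^sup>2)\<^sup>2 + (B0\<^sup>2 - C0\<^sup>2)\<^sup>2"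
      using g(1) by algebra
    then show ?thesis by (smt (verit) zero_le_power2)
  qed
  have "?E = (W\<^sup>2 - 3 * g\<^sup>2)\<^sup>2 - 8 * (W * (A0 * B0 * C0)) - 4 * ((A0 * B0)\<^sup>2 + (A0 * C0)\<^sup>2 + (B0 * C0)\<^sup>2)"
    using prod_hadamard_expand[of W "- A0" "- B0" "- C0"] g(1) by simp
  moreover have "W * (A0 * B0 * C0) \<le> W * g ^ 3"
    using prod3 Wpos by (intro mult_left_mono) auto
  ultimately have "?E \<ge> (W\<^sup>2 - 3 * g\<^sup>2)\<^sup>2 - 8 * (W * g ^ 3) - 12 * g ^ 4"
    using prod2 by (simp del: ring_distribs)
  also have "(W\<^sup>2 - 3 * g\<^sup>2)\<^sup>2 - 8 * (W * g ^ 3) - 12 * g ^ 4 = (w - g) * (w + 3 * g) ^ 3"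
    unfolding W_def by algebra
  finally have lower: "(w - g) * (w + 3 * g) ^ 3 \<le> ?E" .
  have pos: "0 < (w - g) * (w + 3 * g) ^ 3" using g by simp
  have "0 \<le> ?D" using nonneg by (intro mult_nonneg_nonneg)
  then have "(w - g) * (w + 3 * g) ^ 3 * ?D \<le> ?E * ?D"
    using lower by (rule mult_right_mono[rotated])
  also note upper
  also have "((w + 3 * g) * (w - g)) ^ 4 = (w - g) * (w + 3 * g) ^ 3 * ((w + 3 * g) * (w - g) ^ 3)"
    by algebra
  finally show ?thesis using pos by (rule mult_left_le_imp_le)
qed

text \<open>
  Turns the bound of \<open>prod_hadamard_le\<close> into a fourth power whose base is rational in \<open>e\<close> and \<open>g\<^sup>2\<close>.  By
  Bernoulli's inequality the right-hand side is at least \<open>w\<^sup>4 - 6 w g\<^sup>2\<close>, where the left-hand side has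
  \<open>w\<^sup>4 - 6 w\<^sup>2 g\<^sup>2 + 8 w g\<^sup>3\<close>; the surplus \<open>6 w e g\<^sup>2\<close> absorbs the cubic term.
\<close>

lemma spread_le_shifted_power4:
  fixes e g :: real
  assumes g: "0 \<le> g" "4 * g \<le> 3 * e"
  defines "w \<equiv> 1 + e"
  shows "(w + 3 * g) * (w - g) ^ 3 \<le> (w - 3 * g\<^sup>2 / (2 * w\<^sup>2)) ^ 4"
proof -
  have w: "w > 0" using g by (simp add: w_def)
  have "(w - 3 * g\<^sup>2 / (2 * w\<^sup>2)) ^ 4 = w ^ 4 * (1 - 3 * g\<^sup>2 / (2 * w ^ 3)) ^ 4"
    using w by (simp add: power_mult_distrib[symmetric] field_simps eval_nat_numeral)
  also have "\<dots> \<ge> w ^ 4 * (1 - 4 * (3 * g\<^sup>2 / (2 * w ^ 3)))"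
    by (intro mult_left_mono bernoulli_power4) auto
  also have "w ^ 4 * (1 - 4 * (3 * g\<^sup>2 / (2 * w ^ 3))) = w ^ 4 - 6 * w * g\<^sup>2"
    using w by (simp add: field_simps eval_nat_numeral)
  finally have "w ^ 4 - 6 * w * g\<^sup>2 \<le> (w - 3 * g\<^sup>2 / (2 * w\<^sup>2)) ^ 4" .
  moreover have "w ^ 4 - 6 * w * g\<^sup>2 - (w + 3 * g) * (w - g) ^ 3 = 2 * (w * g\<^sup>2) * (3 * e - 4 * g) + 3 * g ^ 4"
    unfolding w_def by algebra
  moreover have "0 \<le> 2 * (w * g\<^sup>2) * (3 * e - 4 * g) + 3 * g ^ 4"
    using w g by (intro add_nonneg_nonneg mult_nonneg_nonneg) auto
  ultimately show ?thesis by linarith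
qed

text \<open>
  The factors \<open>1 + x\<^sub>i y\<^sub>i\<close> have mean \<open>1 + e\<close>, and their deviations have the coordinates
  \<open>A = u\<^sub>1 v\<^sub>2 + u\<^sub>2 v\<^sub>1\<close>, \<open>B = u\<^sub>1 v\<^sub>3 + u\<^sub>3 v\<^sub>1\<close>, \<open>C = u\<^sub>2 v\<^sub>3 + u\<^sub>3 v\<^sub>2\<close>.  By the inequality of arithmetic and
  geometric means these are at least \<open>2 sqrt (k\<^sub>i k\<^sub>j)\<close> with \<open>k\<^sub>i = u\<^sub>i v\<^sub>i\<close>, so the \<open>k\<^sub>i\<close> control the spread.
\<close>

lemma diagonal_bound_nonneg:
  fixes u1 u2 u3 v1 v2 v3 :: real
  assumes nonneg: "0 \<le> u1" "0 \<le> u2" "0 \<le> u3" "0 \<le> v1" "0 \<le> v2" "0 \<le> v3"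
  defines "e \<equiv> u1 * v1 + u2 * v2 + u3 * v3"
    and "q \<equiv> (u1 * v1) * (u2 * v2) + (u1 * v1) * (u3 * v3) + (u2 * v2) * (u3 * v3)"
  assumes z: "0 \<le> 1 + (u1 + u2 + u3) * (v1 + v2 + v3)" "0 \<le> 1 + (u1 - u2 - u3) * (v1 - v2 - v3)"
    "0 \<le> 1 + (- u1 + u2 - u3) * (- v1 + v2 - v3)" "0 \<le> 1 + (- u1 - u2 + u3) * (- v1 - v2 + v3)"
  shows "(1 + (u1 + u2 + u3) * (v1 + v2 + v3)) * (1 + (u1 - u2 - u3) * (v1 - v2 - v3))
    * (1 + (- u1 + u2 - u3) * (- v1 + v2 - v3)) * (1 + (- u1 - u2 + u3) * (- v1 - v2 + v3))
    \<le> (1 + e - 2 * q / (1 + e)\<^sup>2) ^ 4"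
proof -
  define w where "w = 1 + e"
  define A where "A = u1 * v2 + u2 * v1"
  define B where "B = u1 * v3 + u3 * v1"
  define C where "C = u2 * v3 + u3 * v2"
  define g where "g = sqrt (4 * q / 3)"
  have e0: "0 \<le> e" and q0: "0 \<le> q" using nonneg by (simp_all add: e_def q_def)
  have g: "0 \<le> g" "3 * g\<^sup>2 = 4 * q" using q0 by (simp_all add: g_def)
  have q3: "3 * q \<le> e\<^sup>2"
  proof -
    have "2 * (e\<^sup>2 - 3 * q) = (u1 * v1 - u2 * v2)\<^sup>2 + (u1 * v1 - u3 * v3)\<^sup>2 + (u2 * v2 - u3 * v3)\<^sup>2"
      unfolding e_def q_def by algebra
    then show ?thesis by (smt (verit) zero_le_power2)
  qed
  have "(4 * g)\<^sup>2 = 16 * g\<^sup>2" "(3 * e)\<^sup>2 = 9 * e\<^sup>2" by (simp_all add: power_mult_distrib)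
  then have "(4 * g)\<^sup>2 \<le> (3 * e)\<^sup>2"
    using g(2) q3 zero_le_power2[of e] by linarith
  then have ge: "4 * g \<le> 3 * e" using e0 by (intro power2_le_imp_le[of "4 * g"]) auto
  have cross: "2 * sqrt ((s * t) * (s' * t')) \<le> s * t' + s' * t"
    if "0 \<le> s" "0 \<le> t" "0 \<le> s'" "0 \<le> t'" for s t s' t' :: real
    using arith_geo_mean_sqrt[of "s * t'" "s' * t"] that by (simp add: mult_ac)
  have z_eq: "1 + (u1 + u2 + u3) * (v1 + v2 + v3) = w + A + B + C"
    "1 + (u1 - u2 - u3) * (v1 - v2 - v3) = w - A - B + C"
    "1 + (- u1 + u2 - u3) * (- v1 + v2 - v3) = w - A + B - C"
    "1 + (- u1 - u2 + u3) * (- v1 - v2 + v3) = w + A - B - C"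
    unfolding w_def e_def A_def B_def C_def by algebra+
  have "(w + A + B + C) * (w - A - B + C) * (w - A + B - C) * (w + A - B - C)
    \<le> (w + 3 * g) * (w - g) ^ 3"
  proof (rule prod_hadamard_le)
    show "3 * g\<^sup>2 = (2 * sqrt ((u1 * v1) * (u2 * v2)))\<^sup>2 + (2 * sqrt ((u1 * v1) * (u3 * v3)))\<^sup>2
        + (2 * sqrt ((u2 * v2) * (u3 * v3)))\<^sup>2"
      using nonneg g(2) by (simp add: power_mult_distrib q_def del: real_sqrt_mult)
    show "2 * sqrt ((u1 * v1) * (u2 * v2)) \<le> A" "2 * sqrt ((u1 * v1) * (u3 * v3)) \<le> B"
      "2 * sqrt ((u2 * v2) * (u3 * v3)) \<le> C"
      unfolding A_def B_def C_def using nonneg by (auto intro!: cross)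
    show "g < w" using ge e0 by (simp add: w_def)
    show "0 \<le> w + A + B + C" "0 \<le> w - A - B + C" "0 \<le> w - A + B - C" "0 \<le> w + A - B - C"
      using z unfolding z_eq .
  qed (use nonneg g(1) in simp_all)
  also have "\<dots> \<le> (w - 3 * g\<^sup>2 / (2 * w\<^sup>2)) ^ 4"
    unfolding w_def using g(1) ge by (rule spread_le_shifted_power4)
  also have "3 * g\<^sup>2 / (2 * w\<^sup>2) = 2 * q / w\<^sup>2" using g(2) by simp
  finally show ?thesis unfolding z_eq w_def .
qed

section \<open>The off-diagonal factors\<close>

text \<open>
  What remains of \<open>offdiagonal_bound_pos\<close> once the exact terms have cancelled.  In the nonnegative
  variables \<open>1 - k\<^sub>1 - k\<^sub>2 - k\<^sub>3\<close>, \<open>k\<^sub>3\<close>, \<open>k\<^sub>2 - k\<^sub>3\<close>, \<open>k\<^sub>1 - k\<^sub>2\<close> the homogenized difference of the two sides has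
  nonnegative coefficients only.
\<close>

lemma cubic_gap_nonneg:
  fixes k1 k2 k3 :: real
  assumes ord: "k2 \<le> k1" "k3 \<le> k2" "0 \<le> k3" and less: "k1 + k2 + k3 \<le> 1"
  defines "j \<equiv> k2 + k3" and "p \<equiv> k2 * k3"
  defines "R \<equiv> 1 + k1 - j"
  shows "p * (3 * k1 - k1\<^sup>2 + 2 * k1 * j + (k2 - k3)\<^sup>2 - j)
    \<le> R * (2 * k1\<^sup>2 * j - 3 * p * k1 + p * j)"
proof -
  define f where "f = 1 - k1 - k2 - k3"
  define x where "x = k3"
  define y where "y = k2 - k3"
  define z where "z = k1 - k2"
  have nonneg: "0 \<le> f" "0 \<le> x" "0 \<le> y" "0 \<le> z"
    using ord less by (simp_all add: f_def x_def y_def z_def)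
  have k: "k3 = x" "k2 = x + y" "k1 = x + y + z"
    by (simp_all add: x_def y_def z_def)
  have f: "f = 1 - (x + y + z) - (x + y) - x" unfolding f_def k by simp
  have "R * (2 * k1\<^sup>2 * j - 3 * p * k1 + p * j) - p * (3 * k1 - k1\<^sup>2 + 2 * k1 * j + (k2 - k3)\<^sup>2 - j)
    = 2 * f * (x^3 + y^3 + 2 * x\<^sup>2 * y + x\<^sup>2 * z + 2 * x * y\<^sup>2 + 3 * x * y * z + 2 * x * z\<^sup>2 + 2 * y\<^sup>2 * z + y * z\<^sup>2)
    + 2 * (x^3 * y + 2 * x^3 * z + 4 * x\<^sup>2 * y\<^sup>2 + 11 * x\<^sup>2 * y * z + 8 * x\<^sup>2 * z\<^sup>2
      + 5 * x * y^3 + 15 * x * y\<^sup>2 * z + 14 * x * y * z\<^sup>2 + 4 * x * z^3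
      + 2 * y^4 + 6 * y^3 * z + 6 * y\<^sup>2 * z\<^sup>2 + 2 * y * z^3)"
    unfolding R_def j_def p_def k f by algebra
  also have "\<dots> \<ge> 0" using nonneg by simp
  finally show ?thesis by simp
qed

text \<open>
  The numbers \<open>L + 4 k\<^sub>i\<close> are the bounds for the square roots of the three groups of four off-diagonal
  factors, and \<open>\<delta>\<close> is the bound for the diagonal from \<open>diagonal_bound_nonneg\<close>.  Both sides agree in
  the limit \<open>k\<^sub>2 = k\<^sub>3 = 0\<close>, for every \<open>k\<^sub>1\<close>; this is the case of equality of the theorem, and it dictates the
  estimates: \<open>k\<^sub>1\<close> is kept apart from \<open>j = k\<^sub>2 + k\<^sub>3\<close>, and the square roots of \<open>L + 4 k\<^sub>1\<close> and of
  \<open>(L + 4 k\<^sub>2) (L + 4 k\<^sub>3)\<close> are replaced by bounds that are exact to first order along \<open>k\<^sub>2 = k\<^sub>3 = 0\<close> and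
  to second order at the origin, where the two sides of the inequality differ only in the third order.
\<close>

lemma offdiagonal_bound_pos:
  fixes k1 k2 k3 :: real
  assumes ord: "k2 \<le> k1" "k3 \<le> k2" "0 < k3" and less: "k1 + k2 + k3 < 1"
  defines "e \<equiv> k1 + k2 + k3" and "q \<equiv> k1 * k2 + k1 * k3 + k2 * k3"
  defines "L \<equiv> (1 - e)\<^sup>2 - 4 * q"
  defines "\<delta> \<equiv> 1 + e - 2 * q / (1 + e)\<^sup>2"
  assumes m: "0 < L + 4 * k1" "0 < L + 4 * k2" "0 < L + 4 * k3"
  shows "((L + 4 * k1) * (L + 4 * k2) * (L + 4 * k3)) \<le> (\<delta> * (2 - \<delta>)\<^sup>2)\<^sup>2" and "0 < \<delta>" and "\<delta> < 2"
proof -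
  define w where "w = 1 + e"
  define j where "j = k2 + k3"
  define p where "p = k2 * k3"
  define R where "R = 1 + k1 - j"
  define \<nu> where "\<nu> = (k2 - k3)\<^sup>2"
  define M where "M = (1 - k1)\<^sup>2 - 2 * k1 * j + \<nu>"
  define \<eta> where "\<eta> = 2 * q / w\<^sup>2"
  have e: "0 < e" "e < 1" "w > 1" and k: "0 < k1" "0 < k2" "k1 < 1" "k2 < 1"
    using ord less by (auto simp: e_def w_def)
  have q0: "0 < q" using ord k unfolding q_def by (simp add: add_pos_pos)
  have q3: "3 * q \<le> e\<^sup>2"
  proof -
    have "2 * (e\<^sup>2 - 3 * q) = (k1 - k2)\<^sup>2 + (k1 - k3)\<^sup>2 + (k2 - k3)\<^sup>2"
      unfolding e_def q_def by algebra
    then show ?thesis by (smt (verit) zero_le_power2)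
  qed
  have w2: "4 * e \<le> w\<^sup>2"
    using zero_le_power2[of "1 - e"] by (simp add: w_def power2_eq_square algebra_simps)
  have \<eta>w: "\<eta> * w\<^sup>2 = 2 * q" using e by (simp add: \<eta>_def)
  have \<eta>0: "0 < \<eta>" using q0 e by (simp add: \<eta>_def)
  have \<eta>6: "\<eta> \<le> e / 6"
  proof -
    have "e * (4 * e) \<le> e * w\<^sup>2" using w2 e by (intro mult_left_mono) auto
    moreover have "e * (4 * e) = 4 * e\<^sup>2" by (simp add: power2_eq_square)
    ultimately have "6 * (2 * q) \<le> e * w\<^sup>2" using q3 by linarith
    then show ?thesis using e by (simp add: \<eta>_def field_simps)
  qed
  have \<delta>: "\<delta> = w - \<eta>" by (simp add: \<delta>_def w_def \<eta>_def)
  show \<delta>pos: "0 < \<delta>" using \<delta> \<eta>6 e by (simp add: w_def)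
  show \<delta>2: "\<delta> < 2" using \<delta> \<eta>0 e by (simp add: w_def)

  have R0: "0 < R" using ord less e by (simp add: R_def j_def)
  have m1: "L + 4 * k1 = R\<^sup>2 - 4 * p"
    unfolding L_def e_def q_def R_def j_def p_def by algebra
  have m23: "(L + 4 * k2) * (L + 4 * k3) = M\<^sup>2 - 4 * \<nu>"
    unfolding L_def e_def q_def M_def \<nu>_def j_def by algebra
  have \<nu>0: "0 \<le> \<nu>" by (simp add: \<nu>_def)
  have \<nu>1: "\<nu> \<le> k1 * j"
  proof -
    have "\<nu> \<le> k2\<^sup>2" unfolding \<nu>_def using ord by (intro power_mono) auto
    also have "\<dots> \<le> k1 * j" unfolding power2_eq_square using ord k by (intro mult_mono) (auto simp: j_def)
    finally show ?thesis .
  qed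
  have M0: "0 < M"
  proof -
    have "2 * M = (L + 4 * k2) + (L + 4 * k3)"
      unfolding L_def e_def q_def M_def \<nu>_def j_def by algebra
    then show ?thesis using m by simp
  qed
  have M1: "M \<le> 1"
  proof -
    have "(1 - k1)\<^sup>2 \<le> 1" using k by (simp add: power_le_one)
    moreover have "0 \<le> k1 * j" using \<nu>0 \<nu>1 by linarith
    ultimately show ?thesis using \<nu>1 by (simp add: M_def)
  qed
  have \<nu>le1: "\<nu> \<le> 1"
  proof -
    have "k1 * j \<le> 1 * 1" using ord less k by (intro mult_mono) (auto simp: j_def)
    then show ?thesis using \<nu>1 by simp
  qed
  have N0: "0 < M - 2 * \<nu>"
  proof -
    have "(2 * \<nu>)\<^sup>2 \<le> 4 * \<nu>"
      using mult_left_mono[OF \<nu>le1 \<nu>0] by (simp add: power2_eq_square)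
    also have "\<dots> < M\<^sup>2" using mult_pos_pos[OF m(2,3)] m23 by simp
    finally have "2 * \<nu> < M" using M0 by (intro power2_less_imp_less[of "2 * \<nu>" M]) auto
    then show ?thesis by simp
  qed
  have b23: "(L + 4 * k2) * (L + 4 * k3) \<le> (M - 2 * \<nu>)\<^sup>2"
  proof -
    have "\<nu> * M \<le> \<nu>" using M1 \<nu>0 by (simp add: mult_left_le)
    moreover have "(M - 2 * \<nu>)\<^sup>2 = M\<^sup>2 - 4 * (\<nu> * M) + 4 * \<nu>\<^sup>2" by algebra
    ultimately show ?thesis using m23 by (smt (verit) zero_le_power2)
  qed
  have b1: "L + 4 * k1 \<le> (R - 2 * p / R)\<^sup>2"
    unfolding m1 by (rule diff_le_square_tangent[OF R0])
  have R1: "0 < R - 2 * p / R"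
  proof -
    have "0 \<le> p" using ord by (simp add: p_def)
    then have "2 * p < R * R" using m(1) m1 by (simp add: power2_eq_square)
    then show ?thesis using R0 by (simp add: field_simps)
  qed
  \<comment> \<open>\<open>\<delta> (2 - \<delta>)\<^sup>2 = w (1 - e)\<^sup>2 + \<eta> w\<^sup>2 - T\<close>, where the middle term is \<open>2 q\<close>.\<close>
  define T where "T = \<eta> * (4 * e\<^sup>2 + (1 - 3 * e) * \<eta> + \<eta>\<^sup>2)"
  have T_le: "T \<le> 2 * q * e"
  proof -
    have "\<eta> * (1 - 3 * e + \<eta>) \<le> e * (1 - e)\<^sup>2"
    proof (cases "1 - 3 * e + \<eta> \<le> 0")
      case True
      then have "\<eta> * (1 - 3 * e + \<eta>) \<le> 0" using \<eta>0 by (simp add: mult_le_0_iff)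
      also have "\<dots> \<le> e * (1 - e)\<^sup>2" using e by simp
      finally show ?thesis .
    next
      case False
      then have "\<eta> * (1 - 3 * e + \<eta>) \<le> (e / 6) * (1 - 3 * e + e / 6)"
        using \<eta>6 e by (intro mult_mono) auto
      also have "\<dots> \<le> e * (1 - e)\<^sup>2"
      proof -
        have "e * (1 - e)\<^sup>2 - (e / 6) * (1 - 3 * e + e / 6) = e * ((e - 55 / 72)\<^sup>2 + 1295 / 5184)"
          by (simp add: power2_eq_square field_simps)
        moreover have "\<dots> \<ge> 0" using e by simp
        ultimately show ?thesis by linarith
      qed
      finally show ?thesis .
    qed
    moreover have "e * (1 - e)\<^sup>2 = e * w\<^sup>2 - 4 * e\<^sup>2" unfolding w_def by algebra
    ultimately have "4 * e\<^sup>2 + (1 - 3 * e) * \<eta> + \<eta>\<^sup>2 \<le> e * w\<^sup>2"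
      by (simp add: power2_eq_square algebra_simps)
    then have "\<eta> * (4 * e\<^sup>2 + (1 - 3 * e) * \<eta> + \<eta>\<^sup>2) \<le> \<eta> * (e * w\<^sup>2)"
      using \<eta>0 by simp
    also have "\<dots> = 2 * q * e" using \<eta>w by (metis mult.assoc mult.commute)
    finally show ?thesis by (simp add: T_def)
  qed
  define S where "S = 3 * k1 - k1\<^sup>2 + 2 * k1 * j + \<nu> - j"
  define B where "B = 2 * k1\<^sup>2 * j - 3 * p * k1 + p * j"
  define F where "F = 6 * k1\<^sup>2 * j + 2 * k1 * j\<^sup>2 - 4 * p * k1 + 4 * p * j"
  define G where "G = p * S / R"
  have gap: "G \<le> B"
    using cubic_gap_nonneg[OF ord(1,2)] ord less R0
    by (simp add: G_def B_def S_def p_def j_def R_def \<nu>_def field_simps)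
  have RR: "2 * p / R * (M - 2 * \<nu>) = 2 * p - 2 * G"
  proof -
    have "M - 2 * \<nu> = R - S" unfolding M_def R_def S_def by algebra
    moreover have "2 * p / R * (R - S) = 2 * p - 2 * (p * S / R)"
      using R0 by (simp add: field_simps)
    ultimately show ?thesis by (simp add: G_def)
  qed
  have "\<delta> * (2 - \<delta>)\<^sup>2 - (R - 2 * p / R) * (M - 2 * \<nu>)
      = F - 2 * p + 2 * p / R * (M - 2 * \<nu>)
        - T"
  proof -
    have E: "e = k1 + j" and Q: "q = k1 * j + p" and N: "\<nu> = j\<^sup>2 - 4 * p"
      unfolding e_def q_def j_def p_def \<nu>_def by (algebra+)
    have "\<delta> * (2 - \<delta>)\<^sup>2 - R * (M - 2 * \<nu>) = F - 2 * p
      + (\<eta> * w\<^sup>2 - 2 * q) - T"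
      unfolding T_def F_def \<delta> w_def R_def M_def N Q E by algebra
    then show ?thesis using \<eta>w by (simp add: algebra_simps)
  qed
  also have "\<dots> \<ge> F - 2 * B - 2 * q * e"
    unfolding RR using T_le gap by linarith
  also have "F - 2 * B - 2 * q * e = 0"
    unfolding F_def B_def e_def q_def j_def p_def by algebra
  finally have main: "(R - 2 * p / R) * (M - 2 * \<nu>) \<le> \<delta> * (2 - \<delta>)\<^sup>2" by simp
  have "(L + 4 * k1) * ((L + 4 * k2) * (L + 4 * k3)) \<le> (R - 2 * p / R)\<^sup>2 * (M - 2 * \<nu>)\<^sup>2"
    using b1 b23 m by (intro mult_mono) auto
  also have "\<dots> = ((R - 2 * p / R) * (M - 2 * \<nu>))\<^sup>2" by (simp only: power_mult_distrib)
  also have "\<dots> \<le> (\<delta> * (2 - \<delta>)\<^sup>2)\<^sup>2"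
    using main R1 N0 by (intro power_mono mult_nonneg_nonneg) auto
  finally show "(L + 4 * k1) * (L + 4 * k2) * (L + 4 * k3) \<le> (\<delta> * (2 - \<delta>)\<^sup>2)\<^sup>2"
    by (simp add: mult.assoc)
qed

text \<open>
  Here \<open>c = 1 + k\<^sub>3\<close>.  With \<open>\<delta>\<^sup>2 = (c + \<alpha>) (c + \<beta>)\<close> held fixed, the left-hand side is largest for \<open>\<gamma> = \<epsilon>\<close>
  and then grows with the product \<open>\<alpha> \<beta>\<close>, which is at most \<open>(\<delta> - c)\<^sup>2\<close>, reached for \<open>\<alpha> = \<beta> = \<delta> - c\<close>.  In that extreme case the inequality
  comes down to \<open>(2 c - \<delta>) (2 - 2 c + \<delta>) \<le> \<delta> (2 - \<delta>)\<close>, an equality for \<open>c = 1\<close>.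
\<close>

lemma offdiagonal_bound_nonpos:
  fixes c \<alpha> \<beta> \<gamma> \<epsilon> :: real
  assumes c: "c \<le> 1" and nonneg: "0 \<le> \<alpha>" "0 \<le> \<beta>"
    and less: "\<alpha> < c" "\<beta> < c" and prod: "\<gamma> * \<epsilon> = \<alpha> * \<beta>"
  defines "\<delta> \<equiv> sqrt ((c + \<alpha>) * (c + \<beta>))"
  shows "(c - \<alpha>) * (c - \<beta>) * (((2 - c)\<^sup>2 - \<gamma>\<^sup>2) * ((2 - c)\<^sup>2 - \<epsilon>\<^sup>2)) \<le> (\<delta> * (2 - \<delta>)\<^sup>2)\<^sup>2"
    and "0 < \<delta>" and "\<delta> < 2"
proof -
  have c0: "0 < c" using nonneg less by simp
  have \<delta>sq: "\<delta>\<^sup>2 = (c + \<alpha>) * (c + \<beta>)"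
    using nonneg c0 by (simp add: \<delta>_def)
  show \<delta>0: "0 < \<delta>" using nonneg c0 by (simp add: \<delta>_def)
  define s where "s = sqrt (\<alpha> * \<beta>)"
  have s: "0 \<le> s" "s\<^sup>2 = \<alpha> * \<beta>" using nonneg by (simp_all add: s_def)
  have s_le: "2 * s \<le> \<alpha> + \<beta>"
    using mult_le_mean_square[of \<alpha> \<beta>] s nonneg by (intro power2_le_imp_le[of "2 * s"]) (auto simp: power_mult_distrib power_divide)
  have "\<delta>\<^sup>2 - (c + s)\<^sup>2 = c * (\<alpha> + \<beta> - 2 * s)"
    using \<delta>sq s(2) by algebra
  moreover have "0 \<le> c * (\<alpha> + \<beta> - 2 * s)" using s_le c0 by simp
  ultimately have "(c + s)\<^sup>2 \<le> \<delta>\<^sup>2" by linarith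
  then have \<delta>_ge: "c + s \<le> \<delta>" using \<delta>0 by (intro power2_le_imp_le[of "c + s" \<delta>]) auto
  have "\<delta>\<^sup>2 < (2 * c)\<^sup>2"
  proof -
    have "(c + \<alpha>) * (c + \<beta>) < (2 * c) * (2 * c)"
      using nonneg less c0 by (intro mult_strict_mono) auto
    then show ?thesis unfolding \<delta>sq by (simp add: power2_eq_square)
  qed
  then have \<delta>_less: "\<delta> < 2 * c" using c0 by (intro power2_less_imp_less[of \<delta> "2 * c"]) auto
  then show \<delta>2: "\<delta> < 2" using c by simp

  define h where "h = (\<delta> - c)\<^sup>2 - s\<^sup>2"
  define S where "S = (2 - \<delta>) * (2 - 2 * c + \<delta>)"
  define r where "r = (2 * c - \<delta>)\<^sup>2"
  have h0: "0 \<le> h" using \<delta>_ge s(1) by (simp add: h_def power_mono)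
  have r_le: "r \<le> S"
    unfolding r_def S_def power2_eq_square
    using \<delta>_less \<delta>_ge s c by (intro mult_mono) auto
  have r0: "0 \<le> r" by (simp add: r_def)
  have 1: "(c - \<alpha>) * (c - \<beta>) = r - 2 * h"
    unfolding r_def h_def s(2) using \<delta>sq by algebra
  have 2: "((2 - c)\<^sup>2 - \<gamma>\<^sup>2) * ((2 - c)\<^sup>2 - \<epsilon>\<^sup>2) \<le> (S + h)\<^sup>2"
  proof -
    have "(S + h)\<^sup>2 - ((2 - c)\<^sup>2 - \<gamma>\<^sup>2) * ((2 - c)\<^sup>2 - \<epsilon>\<^sup>2) = ((2 - c) * (\<gamma> - \<epsilon>))\<^sup>2"
      unfolding S_def h_def s(2) using prod by algebra
    then show ?thesis by (smt (verit) zero_le_power2)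
  qed
  have "(c - \<alpha>) * (c - \<beta>) * (((2 - c)\<^sup>2 - \<gamma>\<^sup>2) * ((2 - c)\<^sup>2 - \<epsilon>\<^sup>2)) \<le> (r - 2 * h) * (S + h)\<^sup>2"
    unfolding 1[symmetric] using 2 less by (intro mult_left_mono) auto
  also have "\<dots> \<le> r * S\<^sup>2"
  proof -
    have "r * S\<^sup>2 - (r - 2 * h) * (S + h)\<^sup>2 = h * ((S - r) * (2 * S + h) + h * (3 * S + 2 * h))"
      by algebra
    moreover have "0 \<le> h * ((S - r) * (2 * S + h) + h * (3 * S + 2 * h))"
      using h0 r0 r_le by (intro mult_nonneg_nonneg add_nonneg_nonneg) auto
    ultimately show ?thesis by linarith
  qed
  also have "r * S\<^sup>2 = ((2 * c - \<delta>) * (2 - 2 * c + \<delta>) * (2 - \<delta>))\<^sup>2"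
    unfolding r_def S_def by algebra
  also have "\<dots> \<le> (\<delta> * (2 - \<delta>) * (2 - \<delta>))\<^sup>2"
  proof -
    have "\<delta> * (2 - \<delta>) - (2 * c - \<delta>) * (2 - 2 * c + \<delta>) = 4 * ((1 - c) * (\<delta> - c))"
      by algebra
    moreover have "0 \<le> (1 - c) * (\<delta> - c)" using c \<delta>_ge s by simp
    ultimately have "(2 * c - \<delta>) * (2 - 2 * c + \<delta>) \<le> \<delta> * (2 - \<delta>)" by linarith
    then show ?thesis
      using \<delta>_less \<delta>2 c \<delta>0 by (intro power_mono mult_right_mono mult_nonneg_nonneg) auto
  qed
  finally show "(c - \<alpha>) * (c - \<beta>) * (((2 - c)\<^sup>2 - \<gamma>\<^sup>2) * ((2 - c)\<^sup>2 - \<epsilon>\<^sup>2)) \<le> (\<delta> * (2 - \<delta>)\<^sup>2)\<^sup>2"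
    by (simp add: power2_eq_square mult.assoc)
qed

section \<open>Similarly ordered vectors\<close>

text \<open>
  The key inequality.  The number \<open>\<delta>\<close> depends on \<open>x\<close> and \<open>y\<close> only, so one bound serves all \<open>a > b > 0\<close>.
  The order of \<open>x\<close> and \<open>y\<close> makes \<open>u\<^sub>1 \<ge> u\<^sub>2 \<ge> \<bar>u\<^sub>3\<bar>\<close> and \<open>v\<^sub>1 \<ge> v\<^sub>2 \<ge> \<bar>v\<^sub>3\<bar>\<close>; the sign of \<open>u\<^sub>3 v\<^sub>3\<close> decides which
  pairs of factors are replaced by their means.
\<close>

lemma similarly_ordered_bound:
  fixes x1 x2 x3 x4 y1 y2 y3 y4 :: real
  assumes x: "x2 \<le> x1" "x3 \<le> x2" "x4 \<le> x3" "x1 + x2 + x3 + x4 = 0"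
    and y: "y2 \<le> y1" "y3 \<le> y2" "y4 \<le> y3" "y1 + y2 + y3 + y4 = 0"
    and pos: "\<And>s t. s \<in> {x1, x2, x3, x4} \<Longrightarrow> t \<in> {y1, y2, y3, y4} \<Longrightarrow> 0 < 1 + s * t"
  obtains \<delta> where "0 < \<delta>" "\<delta> < 2"
    "(1 + x1 * y1) * (1 + x2 * y2) * (1 + x3 * y3) * (1 + x4 * y4) \<le> \<delta> ^ 4"
    "(1 + x1 * y2) * (1 + x2 * y1) * ((1 + x3 * y4) * (1 + x4 * y3))
      * ((1 + x1 * y3) * (1 + x3 * y1) * ((1 + x2 * y4) * (1 + x4 * y2)))
      * ((1 + x1 * y4) * (1 + x4 * y1) * ((1 + x2 * y3) * (1 + x3 * y2))) \<le> (\<delta> * (2 - \<delta>)\<^sup>2) ^ 4"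
proof -
  have p:
    "0 < 1 + x1 * y1" "0 < 1 + x1 * y2" "0 < 1 + x1 * y3" "0 < 1 + x1 * y4"
    "0 < 1 + x2 * y1" "0 < 1 + x2 * y2" "0 < 1 + x2 * y3" "0 < 1 + x2 * y4"
    "0 < 1 + x3 * y1" "0 < 1 + x3 * y2" "0 < 1 + x3 * y3" "0 < 1 + x3 * y4"
    "0 < 1 + x4 * y1" "0 < 1 + x4 * y2" "0 < 1 + x4 * y3" "0 < 1 + x4 * y4"
    using pos by simp_all
  \<comment> \<open>Walsh-Hadamard coefficients of \<open>x\<close>: as the entries of \<open>x\<close> sum to zero, \<open>u\<^sub>1\<close> is also
    \<open>(x\<^sub>1 + x\<^sub>2 - x\<^sub>3 - x\<^sub>4) / 4\<close>, and so on.\<close>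
  define u1 where "u1 = (x1 + x2) / 2"
  define u2 where "u2 = (x1 + x3) / 2"
  define u3 where "u3 = (x1 + x4) / 2"
  define v1 where "v1 = (y1 + y2) / 2"
  define v2 where "v2 = (y1 + y3) / 2"
  define v3 where "v3 = (y1 + y4) / 2"
  have X: "x1 = u1 + u2 + u3" "x2 = u1 - u2 - u3" "x3 = - u1 + u2 - u3" "x4 = - u1 - u2 + u3"
    using x(4) by (simp_all add: u1_def u2_def u3_def field_simps)
  have Y: "y1 = v1 + v2 + v3" "y2 = v1 - v2 - v3" "y3 = - v1 + v2 - v3" "y4 = - v1 - v2 + v3"
    using y(4) by (simp_all add: v1_def v2_def v3_def field_simps)
  have u: "\<bar>u3\<bar> \<le> u2" "u2 \<le> u1" using x(1-3) unfolding X by linarith+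
  have v: "\<bar>v3\<bar> \<le> v2" "v2 \<le> v1" using y(1-3) unfolding Y by linarith+
  have u0: "0 \<le> u1" "0 \<le> u2" and v0: "0 \<le> v1" "0 \<le> v2" using u v by linarith+
  define k1 where "k1 = u1 * v1"
  define k2 where "k2 = u2 * v2"
  define k3 where "k3 = u3 * v3"
  have k21: "k2 \<le> k1" unfolding k1_def k2_def using u v u0 v0 by (intro mult_mono) auto
  have k32: "k3 \<le> k2"
  proof -
    have "k3 \<le> \<bar>u3\<bar> * \<bar>v3\<bar>" unfolding k3_def by (simp flip: abs_mult)
    also have "\<dots> \<le> k2" unfolding k2_def using u v u0 v0 by (intro mult_mono) auto
    finally show ?thesis .
  qed
  show thesis
  proof (cases "k3 \<le> 0")
    case True
    define \<alpha> where "\<alpha> = (u1 + u2) * (v1 + v2)"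
    define \<beta> where "\<beta> = (u1 - u2) * (v1 - v2)"
    define \<gamma> where "\<gamma> = (u1 + u2) * (v1 - v2)"
    define \<epsilon> where "\<epsilon> = (u1 - u2) * (v1 + v2)"
    have nonneg: "0 \<le> \<alpha>" "0 \<le> \<beta>" using u v u0 v0 by (simp_all add: \<alpha>_def \<beta>_def)
    have prod: "\<gamma> * \<epsilon> = \<alpha> * \<beta>" by (simp add: \<alpha>_def \<beta>_def \<gamma>_def \<epsilon>_def)
    define c where "c = 1 + k3"
    note defs = c_def k3_def \<alpha>_def \<beta>_def \<gamma>_def \<epsilon>_def
    \<comment> \<open>The index \<open>i\<close> is paired with \<open>5 - i\<close>.\<close>
    have d: "(1 + x1 * y1) + (1 + x4 * y4) = 2 * (c + \<alpha>)" "(1 + x2 * y2) + (1 + x3 * y3) = 2 * (c + \<beta>)"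
      unfolding defs X Y by algebra+
    have n: "(1 + x1 * y4) + (1 + x4 * y1) = 2 * (c - \<alpha>)" "(1 + x2 * y3) + (1 + x3 * y2) = 2 * (c - \<beta>)"
      unfolding defs X Y by algebra+
    have o: "(1 + x1 * y2) + (1 + x4 * y3) = 2 * (2 - c + \<gamma>)" "(1 + x1 * y3) + (1 + x4 * y2) = 2 * (2 - c - \<gamma>)"
      "(1 + x2 * y1) + (1 + x3 * y4) = 2 * (2 - c + \<epsilon>)" "(1 + x2 * y4) + (1 + x3 * y1) = 2 * (2 - c - \<epsilon>)"
      unfolding defs X Y by algebra+
    note D = two_pairs_bound[OF p(1) p(16) p(6) p(11) d]
    note N = two_pairs_bound[OF p(4) p(13) p(7) p(10) n]
    note O1 = two_pairs_bound[OF p(2) p(15) p(3) p(14) o(1,2)]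
    note O2 = two_pairs_bound[OF p(5) p(12) p(8) p(9) o(3,4)]
    define \<delta> where "\<delta> = sqrt ((c + \<alpha>) * (c + \<beta>))"
    have c1: "c \<le> 1" using True by (simp add: c_def)
    have less: "\<alpha> < c" "\<beta> < c" using N(3,4) by simp_all
    note bound = offdiagonal_bound_nonpos[OF c1 nonneg less prod, folded \<delta>_def]
    show thesis
    proof (rule that)
      show "0 < \<delta>" "\<delta> < 2" using bound(2,3) .
      note D(2)
      also have "((c + \<alpha>) * (c + \<beta>))\<^sup>2 = (\<delta>\<^sup>2)\<^sup>2"
        using D(3,4) by (simp add: \<delta>_def)
      finally show "(1 + x1 * y1) * (1 + x2 * y2) * (1 + x3 * y3) * (1 + x4 * y4) \<le> \<delta> ^ 4"
        by (simp add: mult_ac)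
      note mult3_mono[OF N(1) O1(1) O2(1) N(2) O1(2) O2(2)]
      also have "((c - \<alpha>) * (c - \<beta>))\<^sup>2 * ((2 - c + \<gamma>) * (2 - c - \<gamma>))\<^sup>2 * ((2 - c + \<epsilon>) * (2 - c - \<epsilon>))\<^sup>2
          = ((c - \<alpha>) * (c - \<beta>) * (((2 - c)\<^sup>2 - \<gamma>\<^sup>2) * ((2 - c)\<^sup>2 - \<epsilon>\<^sup>2)))\<^sup>2"
        by algebra
      also have "\<dots> \<le> ((\<delta> * (2 - \<delta>)\<^sup>2)\<^sup>2)\<^sup>2"
      proof (rule power_mono[OF bound(1)])
        have "((2 - c)\<^sup>2 - \<gamma>\<^sup>2) * ((2 - c)\<^sup>2 - \<epsilon>\<^sup>2)
          = (2 - c + \<gamma>) * (2 - c - \<gamma>) * ((2 - c + \<epsilon>) * (2 - c - \<epsilon>))" by algebra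
        then show "0 \<le> (c - \<alpha>) * (c - \<beta>) * (((2 - c)\<^sup>2 - \<gamma>\<^sup>2) * ((2 - c)\<^sup>2 - \<epsilon>\<^sup>2))"
          using N(3,4) O1(3,4) O2(3,4) by simp
      qed
      finally show "(1 + x1 * y2) * (1 + x2 * y1) * ((1 + x3 * y4) * (1 + x4 * y3))
          * ((1 + x1 * y3) * (1 + x3 * y1) * ((1 + x2 * y4) * (1 + x4 * y2)))
          * ((1 + x1 * y4) * (1 + x4 * y1) * ((1 + x2 * y3) * (1 + x3 * y2))) \<le> (\<delta> * (2 - \<delta>)\<^sup>2) ^ 4"
        by (simp add: mult_ac)
    qed
  next
    case False
    then have k3: "0 < k3" by simp
    define e where "e = k1 + k2 + k3"
    define q where "q = k1 * k2 + k1 * k3 + k2 * k3"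
    define L where "L = (1 - e)\<^sup>2 - 4 * q"
    define A where "A = u1 * v2 + u2 * v1"
    define B where "B = u1 * v3 + u3 * v1"
    define C where "C = u2 * v3 + u3 * v2"
    define w1 where "w1 = 1 + k1 - k2 - k3"
    define w2 where "w2 = 1 + k2 - k1 - k3"
    define w3 where "w3 = 1 + k3 - k1 - k2"
    note defs = w1_def w2_def w3_def A_def B_def C_def k1_def k2_def k3_def
    \<comment> \<open>Each factor is paired with its transpose.\<close>
    have s1: "(1 + x1 * y2) + (1 + x2 * y1) = 2 * (w1 - C)" "(1 + x3 * y4) + (1 + x4 * y3) = 2 * (w1 + C)"
      unfolding defs X Y by algebra+
    have s2: "(1 + x1 * y3) + (1 + x3 * y1) = 2 * (w2 - B)" "(1 + x2 * y4) + (1 + x4 * y2) = 2 * (w2 + B)"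
      unfolding defs X Y by algebra+
    have s3: "(1 + x1 * y4) + (1 + x4 * y1) = 2 * (w3 - A)" "(1 + x2 * y3) + (1 + x3 * y2) = 2 * (w3 + A)"
      unfolding defs X Y by algebra+
    note P1 = two_pairs_bound[OF p(2) p(5) p(12) p(15) s1]
    note P2 = two_pairs_bound[OF p(3) p(9) p(8) p(14) s2]
    note P3 = two_pairs_bound[OF p(4) p(13) p(7) p(10) s3]
    have m_eq: "(w1 - C) * (w1 + C) = L + 4 * k1 - (u2 * v3 - u3 * v2)\<^sup>2"
      "(w2 - B) * (w2 + B) = L + 4 * k2 - (u1 * v3 - u3 * v1)\<^sup>2"
      "(w3 - A) * (w3 + A) = L + 4 * k3 - (u1 * v2 - u2 * v1)\<^sup>2"
      unfolding L_def e_def q_def defs by algebra+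
    have m_le: "(w1 - C) * (w1 + C) \<le> L + 4 * k1" "(w2 - B) * (w2 + B) \<le> L + 4 * k2" "(w3 - A) * (w3 + A) \<le> L + 4 * k3"
      unfolding m_eq by simp_all
    have m_pos: "0 < (w1 - C) * (w1 + C)" "0 < (w2 - B) * (w2 + B)" "0 < (w3 - A) * (w3 + A)"
      using P1(3,4) P2(3,4) P3(3,4) by simp_all
    have less: "e < 1"
    proof -
      have "(2 * k3)\<^sup>2 = 4 * (k3 * k3)" by (simp add: power2_eq_square)
      also have "\<dots> \<le> 4 * (k1 * k2)" using k21 k32 k3 by (intro mult_left_mono mult_mono) auto
      also have "\<dots> = A\<^sup>2 - (u1 * v2 - u2 * v1)\<^sup>2" unfolding A_def k1_def k2_def by algebra
      also have "\<dots> \<le> A\<^sup>2" by simp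
      finally have "2 * k3 \<le> A"
        using u0 v0 by (intro power2_le_imp_le[of "2 * k3" A]) (auto simp: A_def)
      then show ?thesis using P3(3) by (simp add: w3_def e_def)
    qed
    define \<delta> where "\<delta> = 1 + e - 2 * q / (1 + e)\<^sup>2"
    have "0 < L + 4 * k1" "0 < L + 4 * k2" "0 < L + 4 * k3"
      using m_pos m_le by linarith+
    note bound = offdiagonal_bound_pos[OF k21 k32 k3, folded e_def q_def, folded L_def \<delta>_def, OF less this]
    show thesis
    proof (rule that)
      show "0 < \<delta>" "\<delta> < 2" using bound(2,3) .
      have z: "0 \<le> 1 + x1 * y1" "0 \<le> 1 + x2 * y2" "0 \<le> 1 + x3 * y3" "0 \<le> 1 + x4 * y4"
        using p by (simp_all add: less_imp_le)
      show "(1 + x1 * y1) * (1 + x2 * y2) * (1 + x3 * y3) * (1 + x4 * y4) \<le> \<delta> ^ 4"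
      proof (cases "0 \<le> u3")
        case True
        then have "0 \<le> v3" using k3 by (simp add: k3_def zero_less_mult_iff)
        from diagonal_bound_nonneg[OF u0 True v0 this] z show ?thesis
          unfolding X Y \<delta>_def e_def q_def k1_def k2_def k3_def by simp
      next
        case False
        then have "0 \<le> - u3" "0 \<le> - v3" using k3 by (simp_all add: k3_def zero_less_mult_iff)
        \<comment> \<open>Changing the signs of \<open>u\<^sub>3\<close> and \<open>v\<^sub>3\<close> only permutes the four diagonal factors.\<close>
        note flip = diagonal_bound_nonneg[OF u0 this(1) v0 this(2)]
        have "(u1 + u2 + - u3) * (v1 + v2 + - v3) = x4 * y4" "(u1 - u2 - - u3) * (v1 - v2 - - v3) = x3 * y3"
          "(- u1 + u2 - - u3) * (- v1 + v2 - - v3) = x2 * y2" "(- u1 - u2 + - u3) * (- v1 - v2 + - v3) = x1 * y1"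
          unfolding X Y by algebra+
        note flip = flip[unfolded this, OF z(4,3,2,1)]
        have "(1 + x1 * y1) * (1 + x2 * y2) * (1 + x3 * y3) * (1 + x4 * y4)
            = (1 + x4 * y4) * (1 + x3 * y3) * (1 + x2 * y2) * (1 + x1 * y1)" by (simp only: mult_ac)
        also have "\<dots> \<le> \<delta> ^ 4"
          using flip unfolding \<delta>_def e_def q_def k1_def k2_def k3_def by simp
        finally show ?thesis .
      qed
      note mult3_mono[OF P1(1) P2(1) P3(1) P1(2) P2(2) P3(2)]
      also have "((w1 - C) * (w1 + C))\<^sup>2 * ((w2 - B) * (w2 + B))\<^sup>2 * ((w3 - A) * (w3 + A))\<^sup>2
          = ((w1 - C) * (w1 + C) * ((w2 - B) * (w2 + B)) * ((w3 - A) * (w3 + A)))\<^sup>2"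
        by (simp only: power_mult_distrib)
      also have "\<dots> \<le> ((L + 4 * k1) * (L + 4 * k2) * (L + 4 * k3))\<^sup>2"
        using m_le m_pos by (intro power_mono mult3_mono mult_nonneg_nonneg less_imp_le[OF m_pos(1)]
            less_imp_le[OF m_pos(2)] less_imp_le[OF m_pos(3)])
      also have "\<dots> \<le> ((\<delta> * (2 - \<delta>)\<^sup>2)\<^sup>2)\<^sup>2"
        using m_le m_pos by (intro power_mono[OF bound(1)] mult_nonneg_nonneg) auto
      finally show "(1 + x1 * y2) * (1 + x2 * y1) * ((1 + x3 * y4) * (1 + x4 * y3))
          * ((1 + x1 * y3) * (1 + x3 * y1) * ((1 + x2 * y4) * (1 + x4 * y2)))
          * ((1 + x1 * y4) * (1 + x4 * y1) * ((1 + x2 * y3) * (1 + x3 * y2))) \<le> (\<delta> * (2 - \<delta>)\<^sup>2) ^ 4"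
        by simp
    qed
  qed
qed

text \<open>
  Sorting by \<open>x + y\<close> sorts similarly ordered \<open>x\<close> and \<open>y\<close> at the same time, also when there are ties.
\<close>

lemma obtain_common_sorting:
  fixes x y :: "4 \<Rightarrow> real"
  assumes "\<And>i j. 0 \<le> (x i - x j) * (y i - y j)"
  obtains i1 i2 i3 i4 where "distinct [i1, i2, i3, i4]" "UNIV = {i1, i2, i3, i4}"
    "x i2 \<le> x i1" "x i3 \<le> x i2" "x i4 \<le> x i3" "y i2 \<le> y i1" "y i3 \<le> y i2" "y i4 \<le> y i3"
proof -
  define ys :: "4 list" where "ys = [1, 2, 3, 4]"
  have "set ys = UNIV" unfolding ys_def UNIV_4 by (simp only: list.set)
  moreover have "length ys = 4" "distinct ys" by (simp_all add: ys_def)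
  ultimately have ys: "length ys = 4" "distinct ys" "set ys = UNIV" by blast+
  define xs where "xs = sort_key (\<lambda>i. - (x i + y i)) ys"
  have len: "length xs = 4" and dist: "distinct xs" and set: "set xs = UNIV"
    using ys by (simp_all add: xs_def)
  from len obtain i1 i2 i3 i4 where xs4: "xs = [i1, i2, i3, i4]"
    by (auto simp: length_Suc_conv eval_nat_numeral)
  have "sorted (map (\<lambda>i. - (x i + y i)) xs)" unfolding xs_def by (rule sorted_sort_key)
  then have le: "x i2 + y i2 \<le> x i1 + y i1" "x i3 + y i3 \<le> x i2 + y i2" "x i4 + y i4 \<le> x i3 + y i3"
    unfolding xs4 by simp_all
  have both: "x j \<le> x i \<and> y j \<le> y i" if "x j + y j \<le> x i + y i" for i j
    using assms[of i j] that by (auto simp: zero_le_mult_iff)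
  show thesis
  proof (rule that)
    show "distinct [i1, i2, i3, i4]" using dist by (simp only: xs4)
    show "UNIV = {i1, i2, i3, i4}" using set[symmetric] by (simp only: xs4 list.set)
  qed (use both[OF le(1)] both[OF le(2)] both[OF le(3)] in simp_all)
qed

section \<open>Existence of a maximizer\<close>

text \<open>
  Rewrites the rank condition as the solvability of polynomial equations on a compact set, which
  shows that it is preserved under limits.
\<close>

lemma rank_le_2_iff_kernel:
  fixes A :: "real ^ 4 ^ 4"
  shows "rank A \<le> 2 \<longleftrightarrow> (\<exists>u v. norm u = 1 \<and> norm v = 1 \<and> u \<bullet> v = 0 \<and> A *v u = 0 \<and> A *v v = 0)"
proof -
  define N where "N = {y. \<forall>x \<in> span (rows A). orthogonal x y}"
  have N_iff: "y \<in> N \<longleftrightarrow> A *v y = 0" for y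
  proof -
    have "y \<in> N \<longleftrightarrow> (\<forall>x \<in> rows A. orthogonal x y)"
    proof
      assume "y \<in> N"
      then show "\<forall>x \<in> rows A. orthogonal x y" by (simp add: N_def span_base)
    next
      assume *: "\<forall>x \<in> rows A. orthogonal x y"
      have "orthogonal x y" if "x \<in> span (rows A)" for x
        using orthogonal_to_span[OF that, of y] * by (simp add: orthogonal_commute)
      then show "y \<in> N" by (simp add: N_def)
    qed
    also have "\<dots> \<longleftrightarrow> (\<forall>i. A $ i \<bullet> y = 0)"
      by (auto simp: rows_def row_def orthogonal_def)
    also have "\<dots> \<longleftrightarrow> A *v y = 0"
      by (simp add: vec_eq_iff matrix_vector_mul_component)
    finally show ?thesis .
  qed
  have "dim N + dim (span (rows A)) = 4"
    using dim_subspace_orthogonal_to_vectors[of "span (rows A)" UNIV] by (simp add: N_def)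
  then have dimN: "dim N + rank A = 4"
    by (simp add: row_rank_def)
  have subN: "subspace N"
    by (auto simp: N_def subspace_def orthogonal_def inner_add_right)
  show ?thesis
  proof
    assume "rank A \<le> 2"
    then have "2 \<le> dim N" using dimN by simp
    obtain B where B: "B \<subseteq> N" "pairwise orthogonal B" "\<And>x. x \<in> B \<Longrightarrow> norm x = 1" "card B = dim N"
      using orthonormal_basis_subspace[OF subN] by metis
    then have "2 \<le> card B" using \<open>2 \<le> dim N\<close> by simp
    then obtain T where "T \<subseteq> B" "card T = 2" by (rule obtain_subset_with_card_n)
    then obtain u v where uv: "u \<in> B" "v \<in> B" "u \<noteq> v" by (auto simp: card_2_iff)
    then show "\<exists>u v. norm u = 1 \<and> norm v = 1 \<and> u \<bullet> v = 0 \<and> A *v u = 0 \<and> A *v v = 0"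
      using B N_iff by (intro exI[of _ u] exI[of _ v]) (auto simp: pairwise_def orthogonal_def)
  next
    assume "\<exists>u v. norm u = 1 \<and> norm v = 1 \<and> u \<bullet> v = 0 \<and> A *v u = 0 \<and> A *v v = 0"
    then obtain u v where uv: "norm u = 1" "norm v = 1" "u \<bullet> v = 0" "u \<in> N" "v \<in> N"
      using N_iff by auto
    have "u \<noteq> v" using uv by auto
    moreover have "independent {u, v}"
      using uv by (intro pairwise_orthogonal_independent) (auto simp: pairwise_def orthogonal_def inner_commute)
    ultimately have "2 \<le> dim N"
      using independent_card_le_dim[of "{u, v}" N] uv by simp
    then show "rank A \<le> 2" using dimN by simp
  qed
qed

lemma norm_le_entry_sum:
  fixes P :: "real ^ 'n ^ 'm"
  assumes "\<And>i j. 0 \<le> P $ i $ j"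
  shows "norm P \<le> entry_sum P"
proof -
  have "norm P \<le> (\<Sum>i\<in>UNIV. norm (P $ i))"
    unfolding norm_vec_def by (rule L2_set_le_sum) simp
  also have "\<dots> \<le> (\<Sum>i\<in>UNIV. \<Sum>j\<in>UNIV. \<bar>P $ i $ j\<bar>)"
    by (intro sum_mono norm_le_l1_cart)
  finally show ?thesis using assms by (simp add: entry_sum_def)
qed

text \<open>
  The set is the projection of the compact set of triples \<open>(P, u, v)\<close> with \<open>P\<close> in the simplex and
  \<open>u, v\<close> an orthonormal pair in the kernel of \<open>P\<close>.
\<close>

lemma compact_M2: "compact M2"
proof -
  let ?ortho = "\<lambda>(P :: real ^ 4 ^ 4, u :: real ^ 4, v :: real ^ 4).
    (\<forall>i j. 0 \<le> P $ i $ j) \<and> entry_sum P = 1 \<and> norm u = 1 \<and> norm v = 1 \<and> u \<bullet> v = 0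
    \<and> (\<forall>i. P $ i \<bullet> u = 0) \<and> (\<forall>i. P $ i \<bullet> v = 0)"
  let ?K = "Collect ?ortho"
  have "?K = {z. \<forall>i j. 0 \<le> fst z $ i $ j} \<inter> {z. entry_sum (fst z) = 1}
    \<inter> {z. norm (fst (snd z)) = 1} \<inter> {z. norm (snd (snd z)) = 1} \<inter> {z. fst (snd z) \<bullet> snd (snd z) = 0}
    \<inter> {z. \<forall>i. fst z $ i \<bullet> fst (snd z) = 0} \<inter> {z. \<forall>i. fst z $ i \<bullet> snd (snd z) = 0}"
    by auto
  also have "closed \<dots>"
    unfolding entry_sum_def
    by (intro closed_Int closed_Collect_all closed_Collect_eq closed_Collect_le continuous_intros)
  finally have "closed ?K" .
  moreover have "bounded ?K"
  proof -
    have "?K \<subseteq> cball 0 1 \<times> (cball 0 1 \<times> cball 0 1)"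
    proof
      fix z assume z: "z \<in> ?K"
      then have "norm (fst z) \<le> 1" using norm_le_entry_sum[of "fst z"] by (simp add: case_prod_beta)
      then show "z \<in> cball 0 1 \<times> (cball 0 1 \<times> cball 0 1)" using z by (simp add: case_prod_beta mem_Times_iff)
    qed
    then show ?thesis by (rule bounded_subset[rotated]) (intro bounded_Times bounded_cball)
  qed
  ultimately have "compact ?K" by (simp add: compact_eq_bounded_closed)
  then have "compact (fst ` ?K)" by (intro compact_continuous_image continuous_intros)
  moreover have "fst ` ?K = M2"
  proof -
    have mv: "A *v u = 0 \<longleftrightarrow> (\<forall>i. A $ i \<bullet> u = 0)" for A :: "real ^ 4 ^ 4" and u
      by (simp add: vec_eq_iff matrix_vector_mul_component)
    show ?thesis unfolding M2_def rank_le_2_iff_kernel mv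
      by (rule set_eqI) (simp add: image_iff split_paired_Ex; blast)
  qed
  ultimately show ?thesis by simp
qed

lemma U_mat_nth: "U_mat a b $ i $ j = (if i = j then a else b)"
  using exhaust_4[of i] exhaust_4[of j] by (auto simp: U_mat_def vector_def)

lemma likelihood_U_mat:
  assumes "0 < a" "0 < b" "entry_sum P = 1"
  shows "likelihood (U_mat a b) P = (\<Prod>i\<in>UNIV. \<Prod>j\<in>UNIV. P $ i $ j powr (if i = j then a else b))"
  using assms by (simp add: likelihood_def rpow_def U_mat_nth if_distrib cong: if_cong)

lemma likelihood_max_exists:
  assumes "0 < a" "0 < b" "M2 \<noteq> {}"
  obtains P where "P \<in> M2" "\<And>Q. Q \<in> M2 \<Longrightarrow> likelihood (U_mat a b) Q \<le> likelihood (U_mat a b) P"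
proof -
  let ?L = "\<lambda>P :: real ^ 4 ^ 4. \<Prod>i\<in>UNIV. \<Prod>j\<in>UNIV. P $ i $ j powr (if i = j then a else b)"
  have "continuous_on M2 ?L"
    using assms by (intro continuous_intros continuous_on_powr') (auto simp: M2_def)
  then obtain P where "P \<in> M2" "\<And>Q. Q \<in> M2 \<Longrightarrow> ?L Q \<le> ?L P"
    using continuous_attains_sup[OF compact_M2 assms(3), of ?L] by blast
  then show thesis
    using assms(1,2) by (intro that[of P]) (auto simp: likelihood_U_mat M2_def)
qed

definition loglik :: "real \<Rightarrow> real \<Rightarrow> real ^ 4 ^ 4 \<Rightarrow> real" where
  "loglik a b P = (\<Sum>i\<in>UNIV. \<Sum>j\<in>UNIV. (if i = j then a else b) * ln (P $ i $ j))"

lemma likelihood_eq_exp_loglik: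
  assumes "0 < a" "0 < b" "entry_sum P = 1" and pos: "\<And>i j. 0 < P $ i $ j"
  shows "likelihood (U_mat a b) P = exp (loglik a b P)"
proof -
  have "P $ i $ j powr c = exp (c * ln (P $ i $ j))" for i j c
    using pos[of i j] by (simp add: powr_def)
  then show ?thesis
    by (simp add: likelihood_U_mat[OF assms(1-3)] loglik_def exp_sum)
qed

section \<open>Necessary conditions at a maximizer\<close>

lemma row_weight: "(\<Sum>j\<in>UNIV. if i = j then a else b) = a + 3 * (b :: real)" for i :: 4
  using exhaust_4[of i] by (auto simp: sum_4)

lemma transpose_in_M2: "P \<in> M2 \<Longrightarrow> transpose P \<in> M2"
  using sum.swap[of "\<lambda>i j. P $ i $ j" UNIV UNIV] rank_transpose[of P]
  by (simp add: M2_def entry_sum_def transpose_def)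

lemma loglik_transpose: "loglik a b (transpose P) = loglik a b P"
  unfolding loglik_def transpose_def
  by (subst sum.swap) (auto intro!: sum.cong)

text \<open>
  Multiplying one row by \<open>t\<close> and normalizing keeps the rank.  Each row carries the same total weight
  \<open>a + 3 b\<close>, which gives the change of the log-likelihood in closed form.
\<close>

lemma row_rescaling:
  fixes r :: 4
  assumes P: "P \<in> M2" and pos: "\<And>i j. 0 < P $ i $ j" and t: "0 < t"
  defines "s \<equiv> 1 + (t - 1) * (\<Sum>j\<in>UNIV. P $ r $ j)"
  shows "\<exists>Q \<in> M2. (\<forall>i j. 0 < Q $ i $ j) \<and> loglik a b Q = loglik a b P + (a + 3 * b) * (ln t - 4 * ln s)"
proof -
  define c where "c i = (if i = r then t else 1)" for i :: 4
  have s_eq: "s = (\<Sum>i\<in>UNIV. c i * (\<Sum>j\<in>UNIV. P $ i $ j))"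
  proof -
    have "(\<Sum>i\<in>UNIV. c i * (\<Sum>j\<in>UNIV. P $ i $ j))
      = (\<Sum>i\<in>UNIV. (\<Sum>j\<in>UNIV. P $ i $ j) + (if i = r then (t - 1) * (\<Sum>j\<in>UNIV. P $ r $ j) else 0))"
      by (rule sum.cong) (auto simp: c_def algebra_simps)
    also have "\<dots> = entry_sum P + (t - 1) * (\<Sum>j\<in>UNIV. P $ r $ j)"
      by (simp add: sum.distrib entry_sum_def)
    finally show ?thesis using P by (simp add: s_def M2_def)
  qed
  have c_pos: "0 < c i" for i using t by (simp add: c_def)
  have s_pos: "0 < s"
    unfolding s_eq using c_pos pos by (intro sum_pos mult_pos_pos) auto
  define Q :: "real ^ 4 ^ 4" where "Q = (\<chi> i j. c i / s * P $ i $ j)"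
  have Q_pos: "0 < Q $ i $ j" for i j
    using c_pos s_pos pos by (simp add: Q_def)
  have Q_eq: "Q = (\<chi> i k. if i = k then c i / s else 0) ** P"
    by (simp add: Q_def matrix_matrix_mult_def vec_eq_iff mult_delta_left)
  have "rank Q \<le> rank P" unfolding Q_eq by (rule rank_mul_le_right)
  moreover have "entry_sum Q = 1"
    using s_pos by (simp add: entry_sum_def Q_def s_eq flip: sum_distrib_left sum_divide_distrib)
  ultimately have "Q \<in> M2"
    using P Q_pos by (simp add: M2_def less_imp_le)
  moreover have "loglik a b Q = loglik a b P + (a + 3 * b) * (ln t - 4 * ln s)"
  proof -
    have ln_Q: "ln (Q $ i $ j) = (ln (c i) - ln s) + ln (P $ i $ j)" for i j
      using c_pos s_pos pos by (simp add: Q_def ln_mult_pos ln_divide_pos)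
    have "loglik a b Q = (\<Sum>i\<in>UNIV. (\<Sum>j\<in>UNIV. if i = j then a else b) * (ln (c i) - ln s)) + loglik a b P"
      by (simp only: loglik_def ln_Q distrib_left sum.distrib sum_distrib_right)
    also have "(\<Sum>i\<in>UNIV. (\<Sum>j\<in>UNIV. if i = j then a else b) * (ln (c i) - ln s))
        = (a + 3 * b) * ((\<Sum>i\<in>UNIV. ln (c i)) - 4 * ln s)"
      by (simp add: row_weight sum_subtractf flip: sum_distrib_left)
    also have "(\<Sum>i\<in>UNIV. ln (c i)) = ln t"
      by (simp add: c_def if_distrib cong: if_cong)
    finally show ?thesis by simp
  qed
  ultimately show ?thesis using Q_pos by blast
qed

text \<open>
  First-order condition: with \<open>\<rho>\<close> the sum of the row, \<open>4 ln (1 + (t - 1) \<rho>) - ln t\<close> is minimal at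
  \<open>t = 1\<close>, where its derivative is \<open>4 \<rho> - 1\<close>.
\<close>

lemma maximizer_row_sum:
  assumes ab: "0 < a" "0 < b" and P: "P \<in> M2" and pos: "\<And>i j. 0 < P $ i $ j"
    and max: "\<And>Q. Q \<in> M2 \<Longrightarrow> (\<And>i j. 0 < Q $ i $ j) \<Longrightarrow> loglik a b Q \<le> loglik a b P"
  shows "(\<Sum>j\<in>UNIV. P $ r $ j) = 1 / 4"
proof -
  let ?\<rho> = "\<Sum>j\<in>UNIV. P $ r $ j"
  define \<phi> where "\<phi> t = 4 * ln (1 + (t - 1) * ?\<rho>) - ln t" for t
  have \<phi>_nonneg: "\<phi> 1 \<le> \<phi> t" if t: "0 < t" for t
  proof -
    obtain Q where "Q \<in> M2" "\<And>i j. 0 < Q $ i $ j"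
      and Q: "loglik a b Q = loglik a b P + (a + 3 * b) * (ln t - 4 * ln (1 + (t - 1) * ?\<rho>))"
      using row_rescaling[OF P pos t, of a b r] by blast
    then have "(a + 3 * b) * (ln t - 4 * ln (1 + (t - 1) * ?\<rho>)) \<le> 0"
      using max[of Q] by simp
    then have "ln t - 4 * ln (1 + (t - 1) * ?\<rho>) \<le> 0"
      using ab by (simp add: mult_le_0_iff)
    then show ?thesis by (simp add: \<phi>_def)
  qed
  have "(\<phi> has_real_derivative (4 * ?\<rho> - 1)) (at 1)"
    unfolding \<phi>_def by (auto intro!: derivative_eq_intros)
  moreover have "\<forall>t. \<bar>1 - t\<bar> < 1 \<longrightarrow> \<phi> 1 \<le> \<phi> t"
    using \<phi>_nonneg by auto
  ultimately have "4 * ?\<rho> - 1 = 0"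
    by (intro DERIV_local_min[of \<phi> _ 1 1]) simp_all
  then show ?thesis by simp
qed

text \<open>
  The all-one vector lies in the row space since the columns have equal sums.  Subtracting it from
  16 times a row leaves a vector of the row space that is orthogonal to it, since the rows have sum
  \<open>1/4\<close>.  The row space has dimension at most two, so these differences span at most a line.
\<close>

lemma rank_1_deviation:
  fixes P :: "real ^ 4 ^ 4"
  assumes rank: "rank P \<le> 2"
    and rows: "\<And>i. (\<Sum>j\<in>UNIV. P $ i $ j) = 1 / 4" and cols: "\<And>j. (\<Sum>i\<in>UNIV. P $ i $ j) = 1 / 4"
  obtains x y where "\<And>i j. P $ i $ j = (1 + x i * y j) / 16"
    "(\<Sum>i\<in>UNIV. x i) = 0" "(\<Sum>j\<in>UNIV. y j) = 0"
proof -
  let ?W = "span (rows P)"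
  define one :: "real ^ 4" where "one = (\<chi> j. 1)"
  define q where "q i = 16 *\<^sub>R P $ i - one" for i
  have row_in: "P $ i \<in> ?W" for i
    by (intro span_base) (auto simp: rows_def row_def)
  have one_in: "one \<in> ?W"
  proof -
    have "one = 4 *\<^sub>R (\<Sum>i\<in>UNIV. P $ i)"
      by (simp add: one_def vec_eq_iff cols)
    then show ?thesis using row_in by (simp add: span_mul span_sum)
  qed
  have q_in: "q i \<in> ?W" for i
    unfolding q_def using row_in one_in by (intro span_diff span_mul) auto
  have q_one: "q i \<bullet> one = 0" for i
  proof -
    have "q i \<bullet> one = 16 * (\<Sum>j\<in>UNIV. P $ i $ j) - 4"
      by (simp add: q_def one_def inner_vec_def sum_subtractf sum_distrib_left)
    then show ?thesis using rows by simp
  qed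
  have P_q: "P $ i $ j = (1 + q i $ j) / 16" for i j
    by (simp add: q_def one_def)
  show thesis
  proof (cases "\<forall>i. q i = 0")
    case True
    then show thesis using P_q by (intro that[of "\<lambda>_. 0" "\<lambda>_. 0"]) auto
  next
    case False
    then obtain r where r: "q r \<noteq> 0" by blast
    have one0: "one \<noteq> 0" by (simp add: one_def vec_eq_iff)
    have ne: "one \<noteq> q r" using q_one[of r] one0 by auto
    have ind: "independent {one, q r}"
      using one0 r q_one[of r]
      by (intro pairwise_orthogonal_independent) (auto simp: pairwise_def orthogonal_def inner_commute)
    have "dim ?W \<le> card {one, q r}" using rank ne by (simp add: row_rank_def)
    then have W_sub: "?W \<subseteq> span {one, q r}"
      using one_in q_in by (intro card_ge_dim_independent[OF _ ind]) simp_all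
    have "\<exists>c. q i = c *\<^sub>R q r" for i
    proof -
      have "q i \<in> span {one, q r}" using W_sub q_in by blast
      then obtain d c where q: "q i = d *\<^sub>R one + c *\<^sub>R q r"
        by (auto simp: span_insert span_singleton algebra_simps)
      have "0 = d * (one \<bullet> one)"
        using q_one[of i] q_one[of r] unfolding q by (simp add: inner_add_left)
      then have "d = 0" using one0 by simp
      then show ?thesis using q by auto
    qed
    then obtain x where x: "q i = x i *\<^sub>R q r" for i by metis
    show thesis
    proof (rule that)
      show "P $ i $ j = (1 + x i * q r $ j) / 16" for i j
        using P_q[of i j] x[of i] by simp
      have "(\<Sum>i\<in>UNIV. q i) $ j = 16 * (\<Sum>i\<in>UNIV. P $ i $ j) - 4" for j
        by (simp add: q_def one_def sum_subtractf sum_distrib_left)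
      then have "(\<Sum>i\<in>UNIV. q i) = 0" by (simp add: vec_eq_iff cols)
      moreover have "(\<Sum>i\<in>UNIV. q i) = (\<Sum>i\<in>UNIV. x i *\<^sub>R q r)"
        by (rule sum.cong[OF refl x])
      ultimately have "(\<Sum>i\<in>UNIV. x i) *\<^sub>R q r = 0"
        by (simp add: scaleR_sum_left)
      then show "(\<Sum>i\<in>UNIV. x i) = 0" using r by simp
      show "(\<Sum>j\<in>UNIV. q r $ j) = 0"
        using q_one[of r] by (simp add: inner_vec_def one_def)
    qed
  qed
qed

text \<open>
  Exchanging columns \<open>i\<close> and \<open>j\<close> changes only which entries carry the larger exponent \<open>a\<close>.
\<close>

lemma maximizer_swap:
  assumes ab: "0 < b" "b < a" and P: "P \<in> M2" and pos: "\<And>i j. 0 < P $ i $ j"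
    and max: "\<And>Q. Q \<in> M2 \<Longrightarrow> (\<And>i j. 0 < Q $ i $ j) \<Longrightarrow> loglik a b Q \<le> loglik a b P"
  shows "P $ i $ j * P $ j $ i \<le> P $ i $ i * P $ j $ j"
proof (cases "i = j")
  case False
  define \<tau> where "\<tau> = Transposition.transpose i j"
  have bij: "bij \<tau>" by (simp add: \<tau>_def)
  have reindex: "(\<Sum>k\<in>UNIV. g (\<tau> k)) = (\<Sum>k\<in>UNIV. g k)" for g :: "4 \<Rightarrow> real"
    using sum.reindex_bij_betw[OF bij, of g] by simp
  define Q :: "real ^ 4 ^ 4" where "Q = (\<chi> k l. P $ k $ \<tau> l)"
  have Q_pos: "0 < Q $ k $ l" for k l using pos by (simp add: Q_def)
  have Q_eq: "Q = P ** (\<chi> m l. if m = \<tau> l then 1 else 0)"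
    by (simp add: Q_def matrix_matrix_mult_def vec_eq_iff mult_delta_right)
  have "rank Q \<le> rank P" unfolding Q_eq by (rule rank_mul_le_left)
  moreover have "entry_sum Q = entry_sum P"
    by (simp add: entry_sum_def Q_def reindex)
  ultimately have "Q \<in> M2" using P Q_pos by (simp add: M2_def less_imp_le)
  then have le: "loglik a b Q \<le> loglik a b P" using max Q_pos by blast
  \<comment> \<open>The first sum is invariant under permutations of the columns.\<close>
  have split: "loglik a b R = b * (\<Sum>k\<in>UNIV. \<Sum>l\<in>UNIV. ln (R $ k $ l)) + (a - b) * (\<Sum>k\<in>UNIV. ln (R $ k $ k))" for R
  proof -
    have "(if k = l then a else b) * c = b * c + (if k = l then (a - b) * c else 0)" for k l :: 4 and c :: real
      by (simp add: algebra_simps)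
    then show ?thesis
      by (simp add: loglik_def sum.distrib sum_distrib_left)
  qed
  have "(\<Sum>k\<in>UNIV. \<Sum>l\<in>UNIV. ln (Q $ k $ l)) = (\<Sum>k\<in>UNIV. \<Sum>l\<in>UNIV. ln (P $ k $ l))"
    unfolding Q_def by (simp add: reindex[of "\<lambda>l. ln (P $ _ $ l)"])
  then have "(a - b) * (\<Sum>k\<in>UNIV. ln (Q $ k $ k)) \<le> (a - b) * (\<Sum>k\<in>UNIV. ln (P $ k $ k))"
    using le unfolding split by simp
  then have "(\<Sum>k\<in>UNIV. ln (Q $ k $ k)) \<le> (\<Sum>k\<in>UNIV. ln (P $ k $ k))"
    using ab by simp
  moreover have split_off: "(\<Sum>k\<in>UNIV. g k) = (\<Sum>k\<in>UNIV - {i, j}. g k) + (g i + g j)" for g :: "4 \<Rightarrow> real"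
    using False by (subst sum.subset_diff[of "{i, j}"]) auto
  moreover have "(\<Sum>k\<in>UNIV - {i, j}. ln (Q $ k $ k)) = (\<Sum>k\<in>UNIV - {i, j}. ln (P $ k $ k))"
    by (rule sum.cong) (auto simp: Q_def \<tau>_def transpose_apply_other)
  ultimately have "ln (Q $ i $ i) + ln (Q $ j $ j) \<le> ln (P $ i $ i) + ln (P $ j $ j)"
    unfolding split_off[of "\<lambda>k. ln (Q $ k $ k)"] split_off[of "\<lambda>k. ln (P $ k $ k)"] by linarith
  then have "ln (P $ i $ j * P $ j $ i) \<le> ln (P $ i $ i * P $ j $ j)"
    using pos by (simp add: Q_def \<tau>_def ln_mult_pos)
  then show ?thesis using pos by simp
qed simp

section \<open>The maximum likelihood estimate\<close>

lemma P_mat_nth: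
  "P_mat a b $ i $ j = (if (i \<in> {1, 2}) = (j \<in> {1, 2}) then a + b else 2 * b) / (8 * (a + 3 * b))"
  using exhaust_4[of i] exhaust_4[of j] by (auto simp: P_mat_def vector_def)

lemma P_mat_pos: "0 < a \<Longrightarrow> 0 < b \<Longrightarrow> 0 < P_mat a b $ i $ j"
  by (simp add: P_mat_nth)

lemma P_mat_in_M2:
  assumes "0 < a" "0 < b"
  shows "P_mat a b \<in> M2"
proof -
  have "entry_sum (P_mat a b) = (8 * (a + b) + 8 * (2 * b)) / (8 * (a + 3 * b))"
    by (simp add: entry_sum_def sum_4 P_mat_nth add_divide_distrib)
  also have "\<dots> = 1" using assms by (simp add: field_simps)
  finally have "entry_sum (P_mat a b) = 1" .
  moreover have "rank (P_mat a b) \<le> 2"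
  proof -
    have "P_mat a b $ i \<in> {P_mat a b $ 1, P_mat a b $ 3}" for i
      using exhaust_4[of i] by (auto simp: vec_eq_iff P_mat_nth)
    then have "rows (P_mat a b) \<subseteq> {P_mat a b $ 1, P_mat a b $ 3}"
      by (auto simp: rows_def row_def)
    then have "dim (rows (P_mat a b)) \<le> card {P_mat a b $ 1, P_mat a b $ 3}"
      by (intro dim_le_card) (auto intro: span_base)
    also have "\<dots> \<le> 2" by (simp add: card_insert_if)
    finally show ?thesis by (simp add: row_rank_def)
  qed
  ultimately show ?thesis
    using P_mat_pos[OF assms] by (simp add: M2_def less_imp_le)
qed

text \<open>
  The left-hand side is concave in \<open>\<delta>\<close>, and \<open>\<delta>\<^sub>0\<close> is its critical point; the proof adds up the tangent
  bounds of the two logarithms, whose linear parts cancel.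
\<close>

lemma weighted_log_bound:
  fixes a b \<delta> \<delta>0 :: real
  assumes "0 < a" "0 < b" "0 < \<delta>" "\<delta> < 2"
  defines "\<delta>0 \<equiv> 2 * (a + b) / (a + 3 * b)"
  shows "(a + b) * ln \<delta> + 2 * b * ln (2 - \<delta>) \<le> (a + b) * ln \<delta>0 + 2 * b * ln (2 - \<delta>0)"
proof -
  have pos: "0 < \<delta>0" "0 < 2 - \<delta>0" using assms by (simp_all add: field_simps)
  have "ln \<delta> - ln \<delta>0 \<le> \<delta> / \<delta>0 - 1"
    using ln_le_minus_one[of "\<delta> / \<delta>0"] assms(3) pos by (simp add: ln_divide_pos)
  then have "(a + b) * (ln \<delta> - ln \<delta>0) \<le> (a + b) * (\<delta> / \<delta>0 - 1)"
    using assms by (intro mult_left_mono) auto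
  also have "\<dots> = (a + 3 * b) / 2 * \<delta> - (a + b)"
    using assms by (simp add: field_simps)
  finally have 1: "(a + b) * (ln \<delta> - ln \<delta>0) \<le> (a + 3 * b) / 2 * \<delta> - (a + b)" .
  have "ln (2 - \<delta>) - ln (2 - \<delta>0) \<le> (2 - \<delta>) / (2 - \<delta>0) - 1"
    using ln_le_minus_one[of "(2 - \<delta>) / (2 - \<delta>0)"] assms(4) pos by (simp add: ln_divide_pos)
  then have "2 * b * (ln (2 - \<delta>) - ln (2 - \<delta>0)) \<le> 2 * b * ((2 - \<delta>) / (2 - \<delta>0) - 1)"
    using assms by (intro mult_left_mono) auto
  also have "2 - \<delta>0 = 4 * b / (a + 3 * b)"
    using assms by (simp add: field_simps)
  also have "2 * b * ((2 - \<delta>) / (4 * b / (a + 3 * b)) - 1) = (a + 3 * b) / 2 * (2 - \<delta>) - 2 * b"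
    using assms by (simp add: field_simps)
  finally have 2: "2 * b * (ln (2 - \<delta>) - ln (2 - \<delta>0)) \<le> (a + 3 * b) / 2 * (2 - \<delta>) - 2 * b"
    by (simp add: \<open>2 - \<delta>0 = 4 * b / (a + 3 * b)\<close>)
  have "(a + 3 * b) / 2 * \<delta> - (a + b) + ((a + 3 * b) / 2 * (2 - \<delta>) - 2 * b) = 0"
    by (simp add: field_simps)
  with 1 2 show ?thesis by (simp add: right_diff_distrib)
qed

text \<open>
  The diagonal entries of the matrix \<open>P(a, b)\<close>, and four others, are \<open>\<delta>\<^sub>0 / 16\<close>; the remaining eight are
  \<open>(2 - \<delta>\<^sub>0) / 16\<close>.  So the bound of the key inequality, optimized over \<open>\<delta>\<close>, is attained.
\<close>

lemma loglik_le_P_mat: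
  assumes ab: "0 < b" "b < a"
    and P_xy: "\<And>i j. P $ i $ j = (1 + x i * y j) / 16" and pos: "\<And>i j. 0 < P $ i $ j"
    and sum0: "(\<Sum>i\<in>UNIV. x i) = 0" "(\<Sum>j\<in>UNIV. y j) = 0"
    and similar: "\<And>i j. 0 \<le> (x i - x j) * (y i - y j)"
  shows "loglik a b P \<le> loglik a b (P_mat a b)"
proof -
  define \<delta>0 where "\<delta>0 = 2 * (a + b) / (a + 3 * b)"
  have pos1: "0 < 1 + x i * y j" for i j
    using pos[of i j] by (simp add: P_xy)
  obtain i1 i2 i3 i4 where i: "distinct [i1, i2, i3, i4]" "UNIV = {i1, i2, i3, i4}"
    and x: "x i2 \<le> x i1" "x i3 \<le> x i2" "x i4 \<le> x i3"
    and y: "y i2 \<le> y i1" "y i3 \<le> y i2" "y i4 \<le> y i3"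
    by (rule obtain_common_sorting[OF similar])
  have sum_i: "(\<Sum>k\<in>UNIV. g k) = g i1 + g i2 + g i3 + g i4" for g :: "4 \<Rightarrow> real"
    by (subst i(2)) (use i(1) in \<open>simp add: add.assoc\<close>)
  have x0: "x i1 + x i2 + x i3 + x i4 = 0" and y0: "y i1 + y i2 + y i3 + y i4 = 0"
    using sum0 unfolding sum_i by auto
  obtain \<delta> where \<delta>: "0 < \<delta>" "\<delta> < 2"
    and diag: "(1 + x i1 * y i1) * (1 + x i2 * y i2) * (1 + x i3 * y i3) * (1 + x i4 * y i4) \<le> \<delta> ^ 4"
    and off: "(1 + x i1 * y i2) * (1 + x i2 * y i1) * ((1 + x i3 * y i4) * (1 + x i4 * y i3))
      * ((1 + x i1 * y i3) * (1 + x i3 * y i1) * ((1 + x i2 * y i4) * (1 + x i4 * y i2)))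
      * ((1 + x i1 * y i4) * (1 + x i4 * y i1) * ((1 + x i2 * y i3) * (1 + x i3 * y i2))) \<le> (\<delta> * (2 - \<delta>)\<^sup>2) ^ 4"
    by (rule similarly_ordered_bound[OF x x0 y y0]) (use pos1 in auto)
  define l where "l i j = ln (1 + x i * y j)" for i j
  define D where "D = l i1 i1 + l i2 i2 + l i3 i3 + l i4 i4"
  define F where "F = l i1 i2 + l i2 i1 + l i3 i4 + l i4 i3 + l i1 i3 + l i3 i1 + l i2 i4 + l i4 i2
    + l i1 i4 + l i4 i1 + l i2 i3 + l i3 i2"
  have "D \<le> ln (\<delta> ^ 4)"
    unfolding D_def l_def using ln_mono[OF diag] pos1 by (simp add: ln_mult_pos)
  then have D: "D \<le> 4 * ln \<delta>" by (simp add: ln_realpow)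
  have "F \<le> ln ((\<delta> * (2 - \<delta>)\<^sup>2) ^ 4)"
    unfolding F_def l_def using ln_mono[OF off] pos1 by (simp add: ln_mult_pos)
  then have F: "F \<le> 4 * ln \<delta> + 8 * ln (2 - \<delta>)"
    using \<delta> by (simp add: ln_realpow ln_mult_pos)
  have ln_P: "ln (P $ i $ j) = l i j - ln 16" for i j
    using pos1 by (simp add: P_xy l_def ln_divide_pos)
  have ne: "i1 \<noteq> i2" "i1 \<noteq> i3" "i1 \<noteq> i4" "i2 \<noteq> i3" "i2 \<noteq> i4" "i3 \<noteq> i4"
    using i(1) by simp_all
  have "loglik a b P = a * D + b * F - 4 * (a + 3 * b) * ln 16"
    unfolding loglik_def sum_i ln_P D_def F_def
    by (simp only: ne ne[symmetric] if_True if_False refl) (simp add: algebra_simps)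
  also have "\<dots> \<le> a * (4 * ln \<delta>) + b * (4 * ln \<delta> + 8 * ln (2 - \<delta>)) - 4 * (a + 3 * b) * ln 16"
    using ab D F by (intro diff_right_mono add_mono mult_left_mono) auto
  also have "\<dots> = 4 * ((a + b) * ln \<delta> + 2 * b * ln (2 - \<delta>)) - 4 * (a + 3 * b) * ln 16"
    by (simp add: algebra_simps)
  also have "\<dots> \<le> 4 * ((a + b) * ln \<delta>0 + 2 * b * ln (2 - \<delta>0)) - 4 * (a + 3 * b) * ln 16"
    using weighted_log_bound[of a b \<delta>] ab \<delta> by (simp add: \<delta>0_def)
  also have "\<dots> = loglik a b (P_mat a b)"
  proof -
    have \<delta>0: "0 < \<delta>0" "0 < 2 - \<delta>0" using ab by (simp_all add: \<delta>0_def field_simps)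
    have "(a + b) / (8 * (a + 3 * b)) = \<delta>0 / 16" "2 * b / (8 * (a + 3 * b)) = (2 - \<delta>0) / 16"
      using ab by (simp_all add: \<delta>0_def field_simps)
    then have P_mat_\<delta>0: "P_mat a b $ i $ j = (if (i \<in> {1, 2}) = (j \<in> {1, 2}) then \<delta>0 / 16 else (2 - \<delta>0) / 16)" for i j
      unfolding P_mat_nth by (simp only: if_distrib[of "\<lambda>z. z / (8 * (a + 3 * b))"])
    define p where "p = ln (\<delta>0 / 16)"
    define r where "r = ln ((2 - \<delta>0) / 16)"
    have ln_P_mat: "ln (P_mat a b $ i $ j) = (if (i \<in> {1, 2}) = (j \<in> {1, 2}) then p else r)" for i j
      unfolding P_mat_\<delta>0 p_def r_def by (rule if_distrib)
    have "(\<Sum>j\<in>UNIV. (if i = j then a else b) * ln (P_mat a b $ i $ j)) = (a + b) * p + 2 * b * r" for i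
      using exhaust_4[of i] unfolding ln_P_mat sum_4 by (elim disjE) (simp_all add: algebra_simps)
    then have "loglik a b (P_mat a b) = 4 * ((a + b) * p + 2 * b * r)"
      by (simp add: loglik_def)
    moreover have "p = ln \<delta>0 - ln 16" "r = ln (2 - \<delta>0) - ln 16"
      using \<delta>0 by (simp_all add: p_def r_def ln_divide_pos)
    ultimately show ?thesis by (simp add: algebra_simps)
  qed
  finally show ?thesis .
qed

theorem theorem4p4:
  fixes a b :: real
  assumes "a > b" and "b > 0"
  shows "is_arg_max (likelihood (U_mat a b)) (\<lambda>P. P \<in> M2) (P_mat a b)"
proof -
  have ab: "0 < a" "0 < b" "b < a" using assms by auto
  let ?L = "likelihood (U_mat a b)"
  note P_mat = P_mat_in_M2[OF ab(1,2)]
  obtain P where P: "P \<in> M2" and max: "\<And>Q. Q \<in> M2 \<Longrightarrow> ?L Q \<le> ?L P"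
    using likelihood_max_exists[OF ab(1,2)] P_mat by blast
  have L_exp: "?L Q = exp (loglik a b Q)" if "Q \<in> M2" "\<And>i j. 0 < Q $ i $ j" for Q
    using that likelihood_eq_exp_loglik[OF ab(1,2)] by (simp add: M2_def)
  have pos: "0 < P $ i $ j" for i j
  proof (rule ccontr)
    assume "\<not> 0 < P $ i $ j"
    then have zero: "P $ i $ j = 0" using P by (simp add: M2_def order.antisym not_less)
    have "?L P = (\<Prod>i\<in>UNIV. \<Prod>j\<in>UNIV. P $ i $ j powr (if i = j then a else b))"
      using P ab by (intro likelihood_U_mat) (auto simp: M2_def)
    also have "\<dots> = 0"
      by (intro prod_zero bexI[of _ i] bexI[of _ j]) (simp_all add: zero)
    finally show False
      using max[OF P_mat] L_exp[OF P_mat] P_mat_pos[OF ab(1,2)] by simp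
  qed
  have max_log: "loglik a b Q \<le> loglik a b P" if "Q \<in> M2" "\<And>i j. 0 < Q $ i $ j" for Q
    using max[OF that(1)] L_exp[OF that] L_exp[OF P pos] by simp
  have rows: "(\<Sum>j\<in>UNIV. P $ i $ j) = 1 / 4" for i
    by (rule maximizer_row_sum[OF ab(1,2) P pos max_log])
  have "(\<Sum>j\<in>UNIV. transpose P $ i $ j) = 1 / 4" for i
  proof (rule maximizer_row_sum[OF ab(1,2) transpose_in_M2[OF P]])
    show "0 < transpose P $ i $ j" for i j by (simp add: transpose_def pos)
    show "loglik a b Q \<le> loglik a b (transpose P)" if "Q \<in> M2" "\<And>i j. 0 < Q $ i $ j" for Q
      unfolding loglik_transpose using that by (rule max_log)
  qed
  then have cols: "(\<Sum>i\<in>UNIV. P $ i $ j) = 1 / 4" for j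
    by (simp add: transpose_def)
  have rank: "rank P \<le> 2" using P by (simp add: M2_def)
  obtain x y where P_xy: "\<And>i j. P $ i $ j = (1 + x i * y j) / 16"
    and sum0: "(\<Sum>i\<in>UNIV. x i) = 0" "(\<Sum>j\<in>UNIV. y j) = 0"
    using rank_1_deviation[OF rank rows cols] by blast
  have similar: "0 \<le> (x i - x j) * (y i - y j)" for i j
  proof -
    have "(1 + x i * y j) * (1 + x j * y i) \<le> (1 + x i * y i) * (1 + x j * y j)"
      using maximizer_swap[OF ab(2,3) P pos max_log, of i j] by (simp add: P_xy)
    then show ?thesis by (simp add: algebra_simps)
  qed
  have "loglik a b P \<le> loglik a b (P_mat a b)"
    by (rule loglik_le_P_mat[OF ab(2,3) P_xy pos sum0 similar])
  then have "?L P \<le> ?L (P_mat a b)"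
    using L_exp[OF P pos] L_exp[OF P_mat P_mat_pos[OF ab(1,2)]] by simp
  then have "?L Q \<le> ?L (P_mat a b)" if "Q \<in> M2" for Q
    using max[OF that] by simp
  then show ?thesis
    using P_mat by (auto simp: is_arg_max_def not_less)
qed

end
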